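(* Let $q$ be a prime power, let $m,n$ be positive integers, let $\alpha$ be a partition of $m$ and let $\beta$ be a partition of $n$. There exists $A \in M_{m \times n}(q^2)$ such that $AA^*$ is nilpotent, $\mu(A^*A) = \beta$ and $\mu(AA^* ) = \alpha$ if and only if (1) $|\alpha_i - \beta_i| \le 1$ for all $i$; and (2) every component of $\gamma(\alpha,\beta)$ not involving $1$ (i.e. not having $1$ as one of its parts) has even length.
   Context: $M_{m\times n}(q^2)$ is the set of $m \times n$ matrices over $\mathbb{F}_{q^2}$; $A^*$ is the transpose of the matrix obtained from $A$ by raising all entries to the $q$-th power. For a nilpotent square matrix $N$ of size $n$, $\mu(N) = (\mu_1 \ge \mu_2 \ge \cdots)$ is the partition of $n$ given by the sizes of the Jordan blocks of $N$. Partitions are written in non-increasing order and parts equal to $0$ are allowed, i.e. partitions are padded by zeros so that $\alpha_i, \beta_i$ make sense for all $i \geq 1$. $\gamma(\alpha,\beta)$ is the partition whose parts are the $\alpha_i$ for those indices $i$ with $\alpha_i = \beta_i > 0$ (one part for each such index $i$). If $\lambda = (\lambda_1 \ge \cdots \ge \lambda_r > 0)$ is a partition, a component of $\lambda$ is a maximal consecutive subsequence of the parts of $\lambda$ such that the difference of any two consecutive terms is at most $1$; its length is its number of parts. *)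

theory Defs
  imports
    "HOL-Number_Theory.Prime_Powers"
    "HOL-Library.Cardinality"
    "Jordan_Normal_Form.Jordan_Normal_Form_Uniqueness"
begin

definition star :: "nat \<Rightarrow> 'a :: field mat \<Rightarrow> 'a mat" where
  "star q A = transpose_mat (map_mat (\<lambda>x. x ^ q) A)"

definition nilpotent_mat :: "'a :: field mat \<Rightarrow> bool" where
  "nilpotent_mat N \<longleftrightarrow>
     square_mat N \<and> (\<exists>k. N ^\<^sub>m k = 0\<^sub>m (dim_row N) (dim_row N))"

text \<open>
  A partition is the non-increasing list of its positive parts, so that every partition has
  exactly one representation; \<open>part\<close> pads it by zeros and counts the parts from \<open>0\<close>.
\<close>

definition partition_of :: "nat list \<Rightarrow> nat \<Rightarrow> bool" where
  "partition_of ls n \<longleftrightarrow> sorted_wrt (\<ge>) ls \<and> 0 \<notin> set ls \<and> sum_list ls = n"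

definition part :: "nat list \<Rightarrow> nat \<Rightarrow> nat" where
  "part ls i = (if i < length ls then ls ! i else 0)"

text \<open>
  All eigenvalues of a nilpotent matrix are \<open>0\<close>, so only the block sizes of a Jordan normal form
  are recorded. The value is meaningful only for matrices that have a Jordan normal form; this
  includes all nilpotent ones.
\<close>

definition mu :: "'a :: field mat \<Rightarrow> nat list" where
  "mu N = (THE ls. sorted_wrt (\<ge>) ls \<and>
             (\<exists>n_as. jordan_nf N n_as \<and> mset ls = mset (map fst n_as)))"

text \<open>
  Only indices below \<open>length \<alpha>\<close> can contribute to \<open>gamma\<close>, because \<open>part \<alpha> i = 0\<close> beyond.
\<close>

definition gamma :: "nat list \<Rightarrow> nat list \<Rightarrow> nat list" where
  "gamma \<alpha> \<beta> =
     map (part \<alpha>) (filter (\<lambda>i. part \<alpha> i = part \<beta> i \<and> part \<alpha> i > 0) [0..<length \<alpha>])"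

text \<open>
  A run of consecutive parts is given by its range of positions \<open>{i..<j}\<close>, since equal values may
  occur at several positions. Maximality is with respect to inclusion of these ranges. The
  subtraction below does not truncate, because the lists considered are non-increasing.
\<close>

definition run :: "nat list \<Rightarrow> nat \<Rightarrow> nat \<Rightarrow> bool" where
  "run ls i j \<longleftrightarrow> i < j \<and> j \<le> length ls \<and>
     (\<forall>k. i \<le> k \<and> Suc k < j \<longrightarrow> ls ! k - ls ! Suc k \<le> 1)"

definition is_component :: "nat list \<Rightarrow> nat \<Rightarrow> nat \<Rightarrow> bool" where
  "is_component ls i j \<longleftrightarrow> run ls i j \<and>
     (\<forall>i' j'. run ls i' j' \<and> i' \<le> i \<and> j \<le> j' \<longrightarrow> i' = i \<and> j' = j)"

lemma jordan_nf_mset_unique: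
  fixes N :: "'a :: field mat"
  assumes "jordan_nf N xs" and "jordan_nf N ys"
  shows "mset xs = mset ys"
proof (rule multiset_eqI)
  fix x :: "nat \<times> 'a"
  obtain k a where x: "x = (k, a)" by force
  have cnt: "count (mset zs) x = (if k = 0 then 0 else compute_nr_of_jordan_blocks N a k)"
    if "jordan_nf N zs" for zs
  proof (cases "k = 0")
    case True
    with that x show ?thesis
      unfolding jordan_nf_def by (force simp: count_eq_zero_iff)
  next
    case False
    with compute_nr_of_jordan_blocks[OF that, of k a] x show ?thesis
      by (simp add: count_mset count_list_eq_length_filter)
  qed
  show "count (mset xs) x = count (mset ys) x"
    using cnt[OF assms(1)] cnt[OF assms(2)] by simp
qed

lemma mu_eq:
  fixes N :: "'a :: field mat"
  assumes nf: "jordan_nf N n_as"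
  shows "mu N = rev (sort (map fst n_as))"
  unfolding mu_def
proof (rule the_equality, goal_cases)
  case 1
  show ?case using nf by (auto simp: sorted_wrt_rev)
next
  case (2 ls)
  then obtain m_as where m: "sorted_wrt (\<ge>) ls" "jordan_nf N m_as" "mset ls = mset (map fst m_as)"
    by blast
  have "mset (rev ls) = mset (map fst n_as)"
    using m(3) jordan_nf_mset_unique[OF m(2) nf] by simp
  moreover have "sorted (rev ls)"
    using m(1) by (simp add: sorted_wrt_rev)
  ultimately have "sort (map fst n_as) = rev ls"
    by (metis properties_for_sort)
  then show ?case by simp
qed

end

theory Submission
  imports Defs
    "Jordan_Normal_Form.Jordan_Normal_Form_Existence"
    "Jordan_Normal_Form.DL_Rank"
    "HOL-Number_Theory.Residues"
begin

text \<open>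
  Think of \<open>A\<close> and \<open>A\<^sup>*\<close> as one operator \<open>T\<close> on \<open>V \<oplus> W\<close> that exchanges \<open>V\<close> and \<open>W\<close> and is
  self-adjoint for the standard Hermitian forms; its square is \<open>AA\<^sup>*\<close> on \<open>V\<close> and \<open>A\<^sup>*A\<close> on \<open>W\<close>.
  If \<open>T\<close> is nilpotent, \<open>V \<oplus> W\<close> splits into strings \<open>x, T x, T\<^sup>2 x, \<dots>\<close> that alternate between
  \<open>V\<close> and \<open>W\<close>. A string with \<open>r + 1\<close> vectors on one side and \<open>r\<close> on the other adds a part
  \<open>r + 1\<close> to one of the two partitions and \<open>r\<close> to the other. A string with \<open>r\<close> vectors on each
  side adds \<open>r\<close> to both, and there are two kinds of these, starting in \<open>V\<close> or in \<open>W\<close>.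
  Self-adjointness forces both kinds to be equally frequent, because \<open>T\<^sup>k\<close> for odd \<open>k\<close> has the
  same rank on \<open>V\<close> as on \<open>W\<close>, the two restrictions being adjoint. Hence \<open>\<alpha>\<close> and \<open>\<beta>\<close> admit a
  pairing of their parts into pairs \<open>(r + 1, r)\<close>, \<open>(r, r + 1)\<close> and an even number of pairs
  \<open>(r, r)\<close> for every \<open>r > 0\<close> (predicate \<open>matchable\<close>). Instead of constructing the
  decomposition, the proof obtains the numbers of strings as second differences of ranks of words
  in \<open>A\<close> and \<open>A\<^sup>*\<close>; they are not negative by Frobenius's rank inequality (lemmas
  \<open>matchable_mu\<close>, \<open>matchable_mu_star\<close>).

  Conversely it suffices to realize each string of odd length and each pair of strings of even
  length, since block sums preserve everything. On suitable bases the operator is a shift and the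
  Gram matrices are exchange matrices (ones on the antidiagonal). The standard Hermitian form has
  such Gram matrices because it contains hyperbolic planes, which comes down to the existence of
  two elements of norm \<open>-1\<close> (lemmas \<open>exchange_mat_is_gram_matrix\<close>, \<open>realizable_from_selection\<close>,
  \<open>matchable_imp_realizable\<close>).

  It remains to compare an arbitrary pairing with the one by position that the conditions on
  \<open>\<alpha>\<close> and \<open>\<beta>\<close> speak of (lemma \<open>matchable_iff\<close>). Replacing a pair \<open>(r + 1, r)\<close> and a pair
  \<open>(r, r + 1)\<close> by \<open>(r + 1, r + 1)\<close> and \<open>(r, r)\<close>, as long as possible, leads to the pairing by
  position. If \<open>t r\<close> such replacements are made, the number of pairs \<open>(s, s)\<close> with \<open>s > r\<close> has the parity of \<open>t r\<close>.
  Where a value \<open>s > 0\<close> is missing from \<open>\<gamma>(\<alpha>,\<beta>)\<close> no replacement can have touched \<open>s\<close>, so an even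
  number of parts lies above each gap, which is the condition on components. The value \<open>0\<close> puts
  no constraint on \<open>t 0\<close>, and this is why components involving \<open>1\<close> are exempt.
\<close>

section \<open>Pairings of the parts of two partitions\<close>

text \<open>
  For \<open>s > 0\<close> this is the \<open>s\<close>-th part of the conjugate partition.
\<close>

definition conj_part :: "nat list \<Rightarrow> nat \<Rightarrow> nat" where
  "conj_part ls s = length (filter (\<lambda>x. s \<le> x) ls)"

lemma conj_part_Suc: "conj_part ls s = conj_part ls (Suc s) + count (mset ls) s"
  by (induction ls) (auto simp: conj_part_def)

lemma conj_part_antimono: "conj_part ls (Suc s) \<le> conj_part ls s"
  using conj_part_Suc[of ls s] by simp

lemma conj_part_eq_0: "s > sum_list ls \<Longrightarrow> conj_part ls s = 0"
  by (induction ls) (auto simp: conj_part_def)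

text \<open>
  In a non-increasing list the parts that are at least \<open>s\<close> form an initial segment. This is what
  turns statements about positions into statements about multiplicities.
\<close>

lemma less_conj_part_iff_nth:
  assumes "sorted_wrt (\<ge>) ls" "i < length ls"
  shows "i < conj_part ls s \<longleftrightarrow> s \<le> ls ! i"
  using assms
proof (induction ls arbitrary: i)
  case (Cons x xs)
  have *: "filter (\<lambda>y. s \<le> y) xs = []" if "\<not> s \<le> x"
    using Cons.prems that by (force simp: filter_empty_conv)
  show ?case
  proof (cases i)
    case 0
    then show ?thesis using * by (auto simp: conj_part_def)
  next
    case (Suc j)
    have "xs ! j \<le> x" using Cons.prems Suc by simp
    then show ?thesis using Cons.IH[of j] Cons.prems Suc * by (auto simp: conj_part_def)
  qed
qed simp

lemma less_conj_part_iff: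
  assumes "sorted_wrt (\<ge>) ls" "s > 0"
  shows "i < conj_part ls s \<longleftrightarrow> s \<le> part ls i"
proof (cases "i < length ls")
  case True
  then show ?thesis using less_conj_part_iff_nth[OF assms(1) True] by (simp add: part_def)
next
  case False
  have "conj_part ls s \<le> length ls" by (simp add: conj_part_def)
  then show ?thesis using False assms by (simp add: part_def)
qed

text \<open>
  Comparing \<open>\<alpha>\<close> and \<open>\<beta>\<close> position by position amounts to comparing the conjugate partitions:
  a violation at \<open>s\<close> exhibits a violating position, namely the first one whose part in the other
  partition drops below \<open>s\<close>.
\<close>

lemma parts_differ_by_at_most_1_iff:
  assumes "sorted_wrt (\<ge>) \<alpha>" "sorted_wrt (\<ge>) \<beta>"
  shows "(\<forall>i. \<bar>int (part \<alpha> i) - int (part \<beta> i)\<bar> \<le> 1) \<longleftrightarrow>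
         (\<forall>s>0. conj_part \<alpha> (Suc s) \<le> conj_part \<beta> s \<and> conj_part \<beta> (Suc s) \<le> conj_part \<alpha> s)"
    (is "?L \<longleftrightarrow> ?R")
proof
  assume L: ?L
  show ?R
  proof (intro allI impI conjI)
    fix s :: nat assume s: "s > 0"
    show "conj_part \<alpha> (Suc s) \<le> conj_part \<beta> s"
    proof (rule ccontr)
      assume "\<not> ?thesis"
      then have "conj_part \<beta> s < conj_part \<alpha> (Suc s)" by simp
      then have "Suc s \<le> part \<alpha> (conj_part \<beta> s)" using less_conj_part_iff[OF assms(1)] by blast
      moreover have "\<not> s \<le> part \<beta> (conj_part \<beta> s)" using less_conj_part_iff[OF assms(2) s] by blast
      ultimately show False using L[rule_format, of "conj_part \<beta> s"] by linarith
    qed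
    show "conj_part \<beta> (Suc s) \<le> conj_part \<alpha> s"
    proof (rule ccontr)
      assume "\<not> ?thesis"
      then have "conj_part \<alpha> s < conj_part \<beta> (Suc s)" by simp
      then have "Suc s \<le> part \<beta> (conj_part \<alpha> s)" using less_conj_part_iff[OF assms(2)] by blast
      moreover have "\<not> s \<le> part \<alpha> (conj_part \<alpha> s)" using less_conj_part_iff[OF assms(1) s] by blast
      ultimately show False using L[rule_format, of "conj_part \<alpha> s"] by linarith
    qed
  qed
next
  assume R: ?R
  have *: "part \<alpha> i \<le> part \<beta> i + 1" if R: "\<forall>s>0. conj_part \<alpha> (Suc s) \<le> conj_part \<beta> s"
    and a: "sorted_wrt (\<ge>) \<alpha>" "sorted_wrt (\<ge>) \<beta>" for \<alpha> \<beta> i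
  proof (cases "part \<alpha> i \<le> 1")
    case False
    define s where "s = part \<alpha> i - 1"
    have s: "s > 0" "Suc s = part \<alpha> i" using False by (auto simp: s_def)
    then have "i < conj_part \<alpha> (Suc s)" using less_conj_part_iff[OF a(1)] by simp
    then have "i < conj_part \<beta> s" using R s(1) less_le_trans by blast
    then show ?thesis using less_conj_part_iff[OF a(2) s(1)] s(2) by simp
  qed simp
  show ?L
  proof
    fix i
    have "part \<alpha> i \<le> part \<beta> i + 1" "part \<beta> i \<le> part \<alpha> i + 1"
      using *[of \<alpha> \<beta> i] *[of \<beta> \<alpha> i] R assms by auto
    then show "\<bar>int (part \<alpha> i) - int (part \<beta> i)\<bar> \<le> 1" by linarith
  qed
qed

lemma part_antimono:
  assumes "sorted_wrt (\<ge>) ls" "i \<le> j"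
  shows "part ls j \<le> part ls i"
proof (cases "i < j")
  case True
  then show ?thesis using assms by (auto simp: part_def sorted_wrt_iff_nth_less)
next
  case False
  then show ?thesis using assms by simp
qed

lemma sorted_gamma:
  assumes "sorted_wrt (\<ge>) \<alpha>"
  shows "sorted_wrt (\<ge>) (gamma \<alpha> \<beta>)"
proof -
  have "sorted_wrt (\<lambda>i j. part \<alpha> j \<le> part \<alpha> i) [0..<length \<alpha>]"
    by (rule sorted_wrt_mono_rel[OF _ sorted_wrt_upt]) (use part_antimono[OF assms] in auto)
  then show ?thesis unfolding gamma_def sorted_wrt_map by (rule sorted_wrt_filter)
qed

lemma zero_notin_gamma: "0 \<notin> set (gamma \<alpha> \<beta>)"
  by (auto simp: gamma_def)

text \<open>
  The parts equal to \<open>s\<close> occupy an interval of positions in each of \<open>\<alpha>\<close> and \<open>\<beta>\<close>, and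
  \<open>gamma\<close> keeps the intersection of the two intervals.
\<close>

lemma count_gamma:
  assumes "sorted_wrt (\<ge>) \<alpha>" "sorted_wrt (\<ge>) \<beta>" "s > 0"
  shows "count (mset (gamma \<alpha> \<beta>)) s =
    min (conj_part \<alpha> s) (conj_part \<beta> s) - max (conj_part \<alpha> (Suc s)) (conj_part \<beta> (Suc s))"
proof -
  have "count (mset (gamma \<alpha> \<beta>)) s =
      length (filter (\<lambda>i. part \<alpha> i = s \<and> part \<beta> i = s) [0..<length \<alpha>])"
    using assms(3) unfolding gamma_def
    by (auto simp del: mset_map mset_filter
        simp: count_mset count_list_eq_length_filter filter_map intro!: arg_cong[where f = length] filter_cong)
  also have "\<dots> = card {i. i < length \<alpha> \<and> part \<alpha> i = s \<and> part \<beta> i = s}"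
    by (auto simp: length_filter_conv_card intro!: arg_cong[where f = card])
  also have "{i. i < length \<alpha> \<and> part \<alpha> i = s \<and> part \<beta> i = s} = {i. part \<alpha> i = s \<and> part \<beta> i = s}"
    using assms(3) by (auto simp: part_def split: if_splits)
  also have "\<dots> = {max (conj_part \<alpha> (Suc s)) (conj_part \<beta> (Suc s))..<min (conj_part \<alpha> s) (conj_part \<beta> s)}"
  proof (intro Set.set_eqI)
    fix i
    show "i \<in> {i. part \<alpha> i = s \<and> part \<beta> i = s} \<longleftrightarrow>
      i \<in> {max (conj_part \<alpha> (Suc s)) (conj_part \<beta> (Suc s))..<min (conj_part \<alpha> s) (conj_part \<beta> s)}"
      using less_conj_part_iff[OF assms(1), of s i] less_conj_part_iff[OF assms(1), of "Suc s" i]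
        less_conj_part_iff[OF assms(2), of s i] less_conj_part_iff[OF assms(2), of "Suc s" i] assms(3)
      by auto
  qed
  finally show ?thesis by simp
qed

lemma run_extend_left:
  assumes "run ls i j" "0 < i" "ls ! (i - 1) - ls ! i \<le> 1"
  shows "run ls (i - 1) j"
  unfolding run_def
proof (intro conjI allI impI)
  fix k assume k: "i - 1 \<le> k \<and> Suc k < j"
  show "ls ! k - ls ! Suc k \<le> 1"
    using k assms by (cases "k = i - 1") (auto simp: run_def)
qed (use assms in \<open>auto simp: run_def\<close>)

lemma run_extend_right:
  assumes "run ls i j" "j < length ls" "ls ! (j - 1) - ls ! j \<le> 1"
  shows "run ls i (Suc j)"
  unfolding run_def
proof (intro conjI allI impI)
  fix k assume k: "i \<le> k \<and> Suc k < Suc j"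
  show "ls ! k - ls ! Suc k \<le> 1"
    using k assms by (cases "Suc k = j") (auto simp: run_def)
qed (use assms in \<open>auto simp: run_def\<close>)

text \<open>
  Trades a position for a value: where a non-increasing list jumps over \<open>s\<close>, the parts before the
  jump are exactly those that are at least \<open>s\<close>.
\<close>

lemma gap_position:
  assumes "sorted_wrt (\<ge>) ls" "0 < j" "j \<le> length ls" "s < ls ! (j - 1)"
    and "j < length ls \<Longrightarrow> ls ! j < s"
  shows "conj_part ls s = j" "count (mset ls) s = 0"
proof -
  have *: "conj_part ls t = j" if "t \<le> ls ! (j - 1)" "j < length ls \<Longrightarrow> ls ! j < t" for t
  proof (rule antisym)
    show "conj_part ls t \<le> j"
    proof (cases "j < length ls")
      case True
      then show ?thesis using less_conj_part_iff_nth[OF assms(1) True, of t] that by auto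
    next
      case False
      then show ?thesis using assms(3) by (auto simp: conj_part_def intro: order_trans[OF length_filter_le])
    qed
    show "j \<le> conj_part ls t"
      using less_conj_part_iff_nth[OF assms(1), of "j - 1" t] that assms(2,3) by linarith
  qed
  show 1: "conj_part ls s = j" using * assms(4,5) by simp
  have "conj_part ls (Suc s) = j" using * assms(4,5) by force
  then show "count (mset ls) s = 0" using conj_part_Suc[of ls s] 1 by simp
qed

text \<open>
  A component without a part \<open>1\<close> ends just above a missing value \<open>s > 0\<close>, and it starts either at
  the first position or just below a missing value. Its length is therefore a difference of numbers
  \<open>conj_part ls s\<close> for missing \<open>s\<close>. Conversely, the parts above a missing value \<open>s > 0\<close> are a
  union of components without \<open>1\<close>, which are split off one after the other from the end.
\<close>

lemma even_components_iff:
  assumes sorted: "sorted_wrt (\<ge>) ls" and pos: "0 \<notin> set ls"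
  shows "(\<forall>i j. is_component ls i j \<and> 1 \<notin> (!) ls ` {i..<j} \<longrightarrow> even (j - i)) \<longleftrightarrow>
         (\<forall>s>0. count (mset ls) s = 0 \<longrightarrow> even (conj_part ls s))" (is "?L \<longleftrightarrow> ?R")
proof
  assume R: ?R
  show ?L
  proof (intro allI impI)
    fix i j assume ij: "is_component ls i j \<and> 1 \<notin> (!) ls ` {i..<j}"
    then have run: "run ls i j"
      and max: "\<And>i' j'. run ls i' j' \<Longrightarrow> i' \<le> i \<Longrightarrow> j \<le> j' \<Longrightarrow> i' = i \<and> j' = j"
      by (auto simp: is_component_def)
    have le: "i < j" "j \<le> length ls" using run by (auto simp: run_def)
    have mem: "ls ! k \<noteq> 0" if "k < length ls" for k using pos that nth_mem by metis
    have "ls ! (j - 1) \<in> (!) ls ` {i..<j}" using le by auto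
    then have "ls ! (j - 1) \<noteq> 1" using ij by metis
    then have last: "ls ! (j - 1) > 1" using mem[of "j - 1"] le by linarith
    \<comment> \<open>The value just below the last part of the component is missing; it is positive
      because the last part exceeds 1.\<close>
    have "even j"
    proof -
      define s where "s = ls ! (j - 1) - 1"
      have "ls ! j < s" if "j < length ls"
      proof (rule ccontr)
        assume "\<not> ?thesis"
        then have "run ls i (Suc j)" using run_extend_right[OF run that] by (simp add: s_def)
        then show False using max[of i "Suc j"] by simp
      qed
      from gap_position[OF sorted _ le(2) _ this] have "conj_part ls s = j" "count (mset ls) s = 0"
        using le last by (auto simp: s_def)
      moreover have "s > 0" using last by (simp add: s_def)
      ultimately show ?thesis using R by metis
    qed
    moreover have "even i"
    proof (cases "i = 0")
      case False
      \<comment> \<open>The value just above the first part of the component is missing.\<close>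
      define s where "s = ls ! i + 1"
      have "s < ls ! (i - 1)"
      proof (rule ccontr)
        assume "\<not> ?thesis"
        then have "run ls (i - 1) j" using run_extend_left[OF run] False by (simp add: s_def)
        then show False using max[of "i - 1" j] False by simp
      qed
      from gap_position[OF sorted _ _ this] have "conj_part ls s = i" "count (mset ls) s = 0"
        using le False by (auto simp: s_def)
      then show ?thesis using R by (auto simp: s_def)
    qed simp
    ultimately show "even (j - i)" by simp
  qed
next
  assume L: ?L
  show ?R
  proof (intro allI impI)
    fix s :: nat assume "s > 0" "count (mset ls) s = 0"
    then show "even (conj_part ls s)"
    proof (induction "conj_part ls s" arbitrary: s rule: less_induct)
      case less
      define k where "k = conj_part ls s"
      have k: "k \<le> length ls" by (simp add: k_def conj_part_def)
      show ?case
      proof (cases "k = 0")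
        case False
        have s: "conj_part ls (Suc s) = k" using conj_part_Suc[of ls s] less.prems k_def by simp
        have above: "s < ls ! l" if "l < k" for l
          using that s k less_conj_part_iff_nth[OF sorted, of l "Suc s"] by simp
        have below: "ls ! k < s" if "k < length ls"
          using that less_conj_part_iff_nth[OF sorted that, of s] k_def by simp
        have "run ls (k - 1) k" using False k by (auto simp: run_def)
        then have ex: "\<exists>i. run ls i k" by blast
        define i where "i = (LEAST i. run ls i k)"
        have run: "run ls i k" unfolding i_def using ex by (rule LeastI_ex)
        have least: "i \<le> i'" if "run ls i' k" for i' unfolding i_def using that by (rule Least_le)
        have ik: "i < k" using run by (simp add: run_def)
        \<comment> \<open>\<open>run ls i k\<close> with \<open>i\<close> least cannot be extended to the left, and the gap at \<open>s\<close> prevents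
          an extension to the right.\<close>
        have "is_component ls i k"
          unfolding is_component_def
        proof (intro conjI allI impI run)
          fix i' j' assume *: "run ls i' j' \<and> i' \<le> i \<and> k \<le> j'"
          show "j' = k"
          proof (rule ccontr)
            assume "j' \<noteq> k"
            then have "k < j'" "k < length ls" "i' \<le> k - 1" "Suc (k - 1) = k"
              using * False ik by (auto simp: run_def)
            then have "ls ! (k - 1) - ls ! k \<le> 1" using * unfolding run_def by metis
            moreover have "s < ls ! (k - 1)" using above False by simp
            ultimately show False using below[OF \<open>k < length ls\<close>] by linarith
          qed
          then show "i' = i" using least[of i'] * by auto
        qed
        moreover have "1 \<notin> (!) ls ` {i..<k}" using above \<open>s > 0\<close> by force
        ultimately have "even (k - i)" using L by blast
        moreover have "even i"
        proof (cases "i = 0")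
          case i: False
          have "ls ! i + 1 < ls ! (i - 1)"
            using run_extend_left[OF run] i least[of "i - 1"] by (cases "ls ! (i - 1) - ls ! i \<le> 1") auto
          from gap_position[OF sorted _ _ this] have "conj_part ls (ls ! i + 1) = i"
            "count (mset ls) (ls ! i + 1) = 0" using i ik k by auto
          then show ?thesis using less.hyps[of "ls ! i + 1"] ik k_def by simp
        qed simp
        ultimately show ?thesis using ik by (simp add: k_def)
      qed (simp add: k_def)
    qed
  qed
qed


text \<open>
  A pairing of the parts of \<open>\<alpha>\<close> with those of \<open>\<beta>\<close>, both padded by zeros, in which paired parts
  differ by at most \<open>1\<close>: \<open>u r\<close> counts the pairs \<open>(r + 1, r)\<close>, \<open>d r\<close> the pairs \<open>(r, r + 1)\<close>, and
  \<open>e r\<close> the pairs \<open>(r + 1, r + 1)\<close>. Only the multiplicities matter, so the pairing is encoded by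
  them.
\<close>

definition matchable :: "nat list \<Rightarrow> nat list \<Rightarrow> bool" where
  "matchable \<alpha> \<beta> \<longleftrightarrow> (\<exists>u d e. \<forall>r. even (e r) \<and>
     count (mset \<alpha>) (Suc r) = u r + d (Suc r) + e r \<and>
     count (mset \<beta>) (Suc r) = d r + u (Suc r) + e r)"

lemma count_eq_0_of_sum_less: "(s :: nat) > sum_list ls \<Longrightarrow> count (mset ls) s = 0"
  using conj_part_Suc[of ls s] conj_part_eq_0[of ls s] by simp

text \<open>
  The difference \<open>u r - d r\<close> is determined by the two partitions, and \<open>t r = min (u r) (d r)\<close>
  pairs of each of the types \<open>(r + 1, r)\<close>, \<open>(r, r + 1)\<close> can be re-paired into equal parts. This
  gives the pairing by position, so \<open>r + 1\<close> has multiplicity \<open>e r + t r + t (Suc r)\<close> in \<open>gamma\<close>.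
  Summing from the top, the number of parts of \<open>gamma\<close> above \<open>r\<close> has the parity of \<open>t r\<close>; and
  \<open>t r\<close> vanishes if \<open>r + 1\<close> does not occur in \<open>gamma\<close>.
\<close>

lemma matchable_imp_conditions:
  assumes sorted: "sorted_wrt (\<ge>) \<alpha>" "sorted_wrt (\<ge>) \<beta>" and m: "matchable \<alpha> \<beta>"
  shows "\<forall>s>0. conj_part \<alpha> (Suc s) \<le> conj_part \<beta> s \<and> conj_part \<beta> (Suc s) \<le> conj_part \<alpha> s"
    and "\<forall>s>0. count (mset (gamma \<alpha> \<beta>)) s = 0 \<longrightarrow> even (conj_part (gamma \<alpha> \<beta>) s)"
proof -
  obtain u d e where even: "\<And>r. even (e r)"
    and ca: "\<And>r. count (mset \<alpha>) (Suc r) = u r + d (Suc r) + e r"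
    and cb: "\<And>r. count (mset \<beta>) (Suc r) = d r + u (Suc r) + e r"
    using m unfolding matchable_def by metis
  let ?a = "conj_part \<alpha>" and ?b = "conj_part \<beta>" and ?g = "gamma \<alpha> \<beta>"
  define N where "N = sum_list \<alpha> + sum_list \<beta> + sum_list ?g"
  have a: "?a (Suc r) = ?a (Suc (Suc r)) + u r + d (Suc r) + e r" for r
    using conj_part_Suc[of \<alpha> "Suc r"] ca by simp
  have b: "?b (Suc r) = ?b (Suc (Suc r)) + d r + u (Suc r) + e r" for r
    using conj_part_Suc[of \<beta> "Suc r"] cb by simp
  have large: "u r = 0" "d r = 0" "?a (Suc r) = 0" "?b (Suc r) = 0" "conj_part ?g (Suc r) = 0"
    if "r \<ge> N" for r
    using that ca[of r] cb[of r] count_eq_0_of_sum_less[of \<alpha> "Suc r"] count_eq_0_of_sum_less[of \<beta> "Suc r"]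
    by (auto simp: N_def intro!: conj_part_eq_0)
  \<comment> \<open>Downward induction: both sides vanish above all parts.\<close>
  have diff: "?a (Suc r) + d r = ?b (Suc r) + u r" for r
  proof (induction "N - r" arbitrary: r)
    case 0
    then show ?case using large[of r] by simp
  next
    case (Suc k)
    have "k = N - Suc r" using Suc(2) by simp
    from Suc(1)[OF this] show ?case using a[of r] b[of r] by linarith
  qed
  show "\<forall>s>0. ?a (Suc s) \<le> ?b s \<and> ?b (Suc s) \<le> ?a s"
  proof (intro allI impI)
    fix s :: nat assume "s > 0"
    then obtain r where r: "s = Suc r" using gr0_implies_Suc by blast
    show "?a (Suc s) \<le> ?b s \<and> ?b (Suc s) \<le> ?a s"
      unfolding r using a[of r] b[of r] diff[of r] by (intro conjI; linarith)
  qed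
  define t where "t r = min (u r) (d r)" for r
  have g: "count (mset ?g) (Suc r) = e r + t r + t (Suc r)" for r
    unfolding count_gamma[OF sorted zero_less_Suc] t_def
    using a[of r] b[of r] diff[of r] diff[of "Suc r"] by linarith
  have parity: "even (conj_part ?g (Suc r) + t r)" for r
  proof (induction "N - r" arbitrary: r)
    case 0
    then show ?case using large[of r] by (simp add: t_def)
  next
    case (Suc k)
    have "k = N - Suc r" using Suc(2) by simp
    from Suc(1)[OF this] show ?case using conj_part_Suc[of ?g "Suc r"] g[of r] even[of r] by simp blast
  qed
  show "\<forall>s>0. count (mset ?g) s = 0 \<longrightarrow> even (conj_part ?g s)"
  proof (intro allI impI)
    fix s :: nat assume "s > 0" and 0: "count (mset ?g) s = 0"
    then obtain r where r: "s = Suc r" using gr0_implies_Suc by blast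
    then have "t r = 0" using 0 g[of r] by simp
    then show "even (conj_part ?g s)" using parity[of r] r by simp
  qed
qed

text \<open>
  Bookkeeping for the next lemma, with \<open>a, a'\<close> and \<open>b, b'\<close> consecutive parts of the conjugate
  partitions. Subtractions truncate, so of \<open>a - b\<close> and \<open>b - a\<close> one is zero.
\<close>

lemma split_multiplicity:
  fixes a b a' b' t t' :: nat
  assumes "a' \<le> a" "b' \<le> b" "a' \<le> b" "b' \<le> a" "t + t' \<le> min a b - max a' b'"
  shows "a = a' + (((a - b) + t) + ((b' - a') + t') + (min a b - max a' b' - t - t'))"
  using assms by (cases "a \<le> b"; cases "a' \<le> b'") (simp_all add: min_def max_def)

text \<open>
  In the pairing by position, \<open>t r\<close> equal pairs \<open>(r + 1, r + 1)\<close> and \<open>t r\<close> equal pairs \<open>(r, r)\<close> are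
  re-paired into \<open>(r + 1, r)\<close> and \<open>(r, r + 1)\<close>. Taking for \<open>t r\<close> the parity of the number of parts
  of \<open>gamma\<close> above \<open>r\<close> makes the remaining numbers of equal pairs even. They are not negative: if
  \<open>r + 1\<close> is missing from \<open>gamma\<close>, the hypothesis says \<open>t r = t (Suc r) = 0\<close>, and if it occurs
  once, exactly one of \<open>t r\<close>, \<open>t (Suc r)\<close> is \<open>1\<close>.
\<close>

lemma conditions_imp_matchable:
  assumes sorted: "sorted_wrt (\<ge>) \<alpha>" "sorted_wrt (\<ge>) \<beta>"
    and close: "\<forall>s>0. conj_part \<alpha> (Suc s) \<le> conj_part \<beta> s \<and> conj_part \<beta> (Suc s) \<le> conj_part \<alpha> s"
    and even: "\<forall>s>0. count (mset (gamma \<alpha> \<beta>)) s = 0 \<longrightarrow> even (conj_part (gamma \<alpha> \<beta>) s)"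
  shows "matchable \<alpha> \<beta>"
proof -
  let ?a = "conj_part \<alpha>" and ?b = "conj_part \<beta>" and ?g = "gamma \<alpha> \<beta>"
  define t where "t r = conj_part ?g (Suc r) mod 2" for r
  define u where "u r = (?a (Suc r) - ?b (Suc r)) + t r" for r
  define d where "d r = (?b (Suc r) - ?a (Suc r)) + t r" for r
  define e where "e r = count (mset ?g) (Suc r) - t r - t (Suc r)" for r
  have step: "conj_part ?g (Suc r) = conj_part ?g (Suc (Suc r)) + count (mset ?g) (Suc r)" for r
    by (rule conj_part_Suc)
  have t_le: "t r \<le> 1" for r by (simp add: t_def)
  have le: "t r + t (Suc r) \<le> count (mset ?g) (Suc r)" for r
  proof -
    consider "count (mset ?g) (Suc r) = 0" | "count (mset ?g) (Suc r) = 1" | "count (mset ?g) (Suc r) \<ge> 2"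
      by linarith
    then show ?thesis
    proof cases
      case 1
      then have "even (conj_part ?g (Suc r))" using even by blast
      moreover have "conj_part ?g (Suc (Suc r)) = conj_part ?g (Suc r)" using 1 step[of r] by linarith
      ultimately show ?thesis by (simp add: t_def)
    next
      case 2
      then show ?thesis using step[of r] by (simp add: t_def) presburger
    next
      case 3
      then show ?thesis using t_le[of r] t_le[of "Suc r"] by linarith
    qed
  qed
  have "even (e r)" for r
  proof -
    have "even (conj_part ?g (Suc r) + t r)" "even (conj_part ?g (Suc (Suc r)) + t (Suc r))"
      unfolding t_def by presburger+
    then show ?thesis using le[of r] step[of r] unfolding e_def by presburger
  qed
  moreover have "count (mset \<alpha>) (Suc r) = u r + d (Suc r) + e r"
      "count (mset \<beta>) (Suc r) = d r + u (Suc r) + e r" for r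
  proof -
    have c: "?a (Suc (Suc r)) \<le> ?b (Suc r)" "?b (Suc (Suc r)) \<le> ?a (Suc r)" using close by auto
    note mono = conj_part_antimono[of \<alpha> "Suc r"] conj_part_antimono[of \<beta> "Suc r"]
    note le' = le[of r, unfolded count_gamma[OF sorted zero_less_Suc]]
    show "count (mset \<alpha>) (Suc r) = u r + d (Suc r) + e r"
      using split_multiplicity[OF mono c le'] conj_part_Suc[of \<alpha> "Suc r"]
      unfolding u_def d_def e_def count_gamma[OF sorted zero_less_Suc] by linarith
    show "count (mset \<beta>) (Suc r) = d r + u (Suc r) + e r"
      using split_multiplicity[OF mono(2,1) c(2,1)] le' conj_part_Suc[of \<beta> "Suc r"]
      unfolding u_def d_def e_def count_gamma[OF sorted zero_less_Suc]
      by (simp add: min.commute max.commute)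
  qed
  ultimately show ?thesis unfolding matchable_def by blast
qed

lemma matchable_iff:
  assumes "sorted_wrt (\<ge>) \<alpha>" "sorted_wrt (\<ge>) \<beta>"
  shows "matchable \<alpha> \<beta> \<longleftrightarrow>
    (\<forall>i. \<bar>int (part \<alpha> i) - int (part \<beta> i)\<bar> \<le> 1) \<and>
    (\<forall>i j. is_component (gamma \<alpha> \<beta>) i j \<and> 1 \<notin> (!) (gamma \<alpha> \<beta>) ` {i..<j} \<longrightarrow> even (j - i))"
  unfolding parts_differ_by_at_most_1_iff[OF assms]
    even_components_iff[OF sorted_gamma[OF assms(1)] zero_notin_gamma]
  using matchable_imp_conditions[OF assms] conditions_imp_matchable[OF assms] by blast


section \<open>Ranks of matrices over a finite field\<close>

lemma bij_betw_list_of_vec: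
  "bij_betw list_of_vec (carrier_vec n) {xs. set xs \<subseteq> UNIV \<and> length xs = n}"
proof (rule bij_betwI[where g = vec_of_list])
  show "list_of_vec \<in> carrier_vec n \<rightarrow> {xs. set xs \<subseteq> UNIV \<and> length xs = n}"
    by (auto dest: carrier_vecD)
  show "vec_of_list \<in> {xs. set xs \<subseteq> UNIV \<and> length xs = n} \<rightarrow> carrier_vec n"
    by (auto intro: carrier_vecI)
qed (simp_all add: vec_list list_vec)

lemma finite_carrier_vec [simp]: "finite (carrier_vec n :: 'a :: finite vec set)"
  using bij_betw_finite[OF bij_betw_list_of_vec[where 'a = 'a]] finite_lists_length_eq[of "UNIV :: 'a set" n] by simp

lemma card_carrier_vec: "card (carrier_vec n :: 'a :: finite vec set) = CARD('a) ^ n"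
  using bij_betw_same_card[OF bij_betw_list_of_vec[where 'a = 'a]] card_lists_length_eq[of "UNIV :: 'a set" n] by simp

text \<open>
  All fibres of a homomorphism are translates of its kernel. Over a finite field this replaces
  rank-nullity: dimensions become exponents of cardinalities.
\<close>

lemma card_eq_card_image_times_kernel:
  assumes G: "G \<subseteq> carrier_vec n" "finite G" and K: "K \<subseteq> G"
    and f: "\<And>x y. x \<in> G \<Longrightarrow> y \<in> G \<Longrightarrow> f x = f y \<longleftrightarrow> y - x \<in> K"
    and add: "\<And>x k. x \<in> G \<Longrightarrow> k \<in> K \<Longrightarrow> x + k \<in> G"
  shows "card G = card (f ` G) * card (K :: 'a :: ab_group_add vec set)"
proof -
  have fibre: "card {y \<in> G. f y = z} = card K" if z: "z \<in> f ` G" for z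
  proof -
    obtain x where x: "x \<in> G" "z = f x" using z by blast
    have "bij_betw (\<lambda>k. x + k) K {y \<in> G. f y = z}"
    proof (rule bij_betwI[where g = "\<lambda>y. y - x"])
      show "(\<lambda>k. x + k) \<in> K \<rightarrow> {y \<in> G. f y = z}"
      proof
        fix k assume k: "k \<in> K"
        have "x \<in> carrier_vec n" "k \<in> carrier_vec n" using k x(1) G(1) K by blast+
        then have "x + k - x = k" by (intro eq_vecI) auto
        then show "x + k \<in> {y \<in> G. f y = z}" using f[OF x(1) add[OF x(1) k]] k add[OF x(1) k] x by auto
      qed
      show "(\<lambda>y. y - x) \<in> {y \<in> G. f y = z} \<rightarrow> K"
      proof
        fix y assume "y \<in> {y \<in> G. f y = z}"
        then have "y \<in> G" "f x = f y" using x(2) by auto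
        then show "y - x \<in> K" using f[OF x(1)] by blast
      qed
      show "x + k - x = k" if "k \<in> K" for k
      proof -
        have "x \<in> carrier_vec n" "k \<in> carrier_vec n" using that x(1) G(1) K by blast+
        then show ?thesis by (intro eq_vecI) auto
      qed
      show "x + (y - x) = y" if "y \<in> {y \<in> G. f y = z}" for y
      proof -
        have "x \<in> carrier_vec n" "y \<in> carrier_vec n" using that x(1) G(1) by blast+
        then show ?thesis by (intro eq_vecI) auto
      qed
    qed
    then show ?thesis using bij_betw_same_card by metis
  qed
  have "card G = (\<Sum>z\<in>f ` G. card {y \<in> G. f y = z})"
    using sum.image_gen[OF G(2), of "\<lambda>_. 1::nat" f] by simp
  also have "\<dots> = card (f ` G) * card K" using fibre by simp
  finally show ?thesis .
qed

definition mat_image :: "'a :: semiring_0 mat \<Rightarrow> 'a vec set" where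
  "mat_image M = (\<lambda>v. M *\<^sub>v v) ` carrier_vec (dim_col M)"

lemma mat_image_subset: "M \<in> carrier_mat nr nc \<Longrightarrow> mat_image M \<subseteq> carrier_vec nr"
  by (auto simp: mat_image_def)

lemma mat_image_mult:
  assumes "X \<in> carrier_mat a b" "Y \<in> carrier_mat b c"
  shows "mat_image (X * Y) = (\<lambda>v. X *\<^sub>v v) ` mat_image Y"
  using assms by (auto simp: mat_image_def image_image intro!: image_cong)

lemma card_subspace_eq:
  fixes M :: "'a :: {finite, field} mat"
  assumes M: "M \<in> carrier_mat nr nc" and W: "W \<subseteq> carrier_vec nc"
    and add: "\<And>x y. x \<in> W \<Longrightarrow> y \<in> W \<Longrightarrow> x + y \<in> W"
    and diff: "\<And>x y. x \<in> W \<Longrightarrow> y \<in> W \<Longrightarrow> x - y \<in> W"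
  shows "card W = card ((\<lambda>v. M *\<^sub>v v) ` W) * card (W \<inter> mat_kernel M)"
proof (rule card_eq_card_image_times_kernel[OF W])
  show "finite W" using finite_subset[OF W] by simp
  fix x y assume xy: "x \<in> W" "y \<in> W"
  then have c: "x \<in> carrier_vec nc" "y \<in> carrier_vec nc" using W by auto
  have *: "M *\<^sub>v (y - x) = M *\<^sub>v y - M *\<^sub>v x"
    using mult_minus_distrib_mat_vec[OF M c(2,1)] .
  have "M *\<^sub>v x = M *\<^sub>v y \<longleftrightarrow> M *\<^sub>v y - M *\<^sub>v x = 0\<^sub>v nr"
  proof
    assume "M *\<^sub>v y - M *\<^sub>v x = 0\<^sub>v nr"
    then have "(M *\<^sub>v y - M *\<^sub>v x) $ i = 0" if "i < nr" for i using that by simp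
    then show "M *\<^sub>v x = M *\<^sub>v y" using M by (intro eq_vecI) auto
  qed (use M in auto)
  then show "M *\<^sub>v x = M *\<^sub>v y \<longleftrightarrow> y - x \<in> W \<inter> mat_kernel M"
    using * diff[OF xy(2,1)] c unfolding mat_kernel[OF M] by auto
qed (use add in auto)

lemma mat_image_add:
  fixes M :: "'a :: field mat"
  assumes "x \<in> mat_image M" "y \<in> mat_image M"
  shows "x + y \<in> mat_image M" "x - y \<in> mat_image M"
proof -
  have M: "M \<in> carrier_mat (dim_row M) (dim_col M)" by simp
  obtain v w where v: "v \<in> carrier_vec (dim_col M)" "x = M *\<^sub>v v"
    and w: "w \<in> carrier_vec (dim_col M)" "y = M *\<^sub>v w" using assms by (auto simp: mat_image_def)
  show "x + y \<in> mat_image M" unfolding mat_image_def v w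
    by (rule image_eqI[where x = "v + w"]) (use v w mult_add_distrib_mat_vec[OF M] in auto)
  show "x - y \<in> mat_image M" unfolding mat_image_def v w
    by (rule image_eqI[where x = "v - w"]) (use v w mult_minus_distrib_mat_vec[OF M] in auto)
qed

lemma card_image_kernel:
  fixes M :: "'a :: {finite, field} mat"
  assumes "M \<in> carrier_mat nr nc"
  shows "CARD('a) ^ nc = card (mat_image M) * card (mat_kernel M)"
  using card_subspace_eq[OF assms subset_refl] assms mat_kernel_carrier[OF assms]
  by (simp add: card_carrier_vec mat_image_def Int_absorb1)

text \<open>
  Coordinates with respect to a basis of the kernel.
\<close>

lemma card_mat_kernel:
  fixes M :: "'a :: {finite, field} mat"
  assumes M: "M \<in> carrier_mat nr nc"
  shows "card (mat_kernel M) = CARD('a) ^ kernel_dim M"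
proof -
  interpret kernel nr nc M by unfold_locales (rule M)
  obtain B where B: "finite B" "basis B" using kernel_basis_exists[OF M] by blast
  then have BinC: "B \<subseteq> mat_kernel M" by (auto simp: Ker.basis_def)
  have ex1: "\<exists>!a. a \<in> B \<rightarrow>\<^sub>E UNIV \<and> lincomb a B = v" if "v \<in> mat_kernel M" for v
    using Ker.basis_criterion[OF B(1) BinC] B(2) that by blast
  have "bij_betw (\<lambda>a. lincomb a B) (B \<rightarrow>\<^sub>E UNIV) (mat_kernel M)"
    unfolding bij_betw_def
  proof
    have closed: "lincomb a B \<in> mat_kernel M" for a
      by (rule Ker.lincomb_closed[OF BinC]) auto
    show "inj_on (\<lambda>a. lincomb a B) (B \<rightarrow>\<^sub>E UNIV)"
      using ex1 closed by (intro inj_onI) metis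
    show "(\<lambda>a. lincomb a B) ` (B \<rightarrow>\<^sub>E UNIV) = mat_kernel M"
      using ex1 closed by (auto simp: image_iff) metis
  qed
  then have "card (mat_kernel M) = card (B \<rightarrow>\<^sub>E (UNIV :: 'a set))"
    using bij_betw_same_card by metis
  also have "\<dots> = CARD('a) ^ card B" using B(1) by (simp add: card_PiE)
  also have "card B = kernel_dim M" using Ker.dim_basis[OF B] by simp
  finally show ?thesis .
qed

lemma card_field_ge_2: "CARD('a :: {finite, field}) \<ge> 2"
  using card_mono[of UNIV "{0, 1 :: 'a}"] by simp

definition mat_rank :: "'a :: field mat \<Rightarrow> nat" where
  "mat_rank M = dim_col M - kernel_dim M"

lemma kernel_dim_le:
  fixes M :: "'a :: {finite, field} mat"
  assumes M: "M \<in> carrier_mat nr nc"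
  shows "kernel_dim M \<le> nc"
proof -
  have "CARD('a) ^ kernel_dim M \<le> CARD('a) ^ nc"
    using card_mono[OF _ mat_kernel_carrier[OF M]] by (simp add: card_mat_kernel[OF M] card_carrier_vec)
  then show ?thesis using card_field_ge_2[where 'a = 'a] by simp
qed

lemma card_mat_image:
  fixes M :: "'a :: {finite, field} mat"
  shows "card (mat_image M) = CARD('a) ^ mat_rank M"
proof -
  have M: "M \<in> carrier_mat (dim_row M) (dim_col M)" by simp
  have "CARD('a) ^ dim_col M = CARD('a) ^ mat_rank M * CARD('a) ^ kernel_dim M"
    using kernel_dim_le[OF M] by (simp add: mat_rank_def flip: power_add)
  then show ?thesis
    using card_image_kernel[OF M] card_field_ge_2[where 'a = 'a] by (simp add: card_mat_kernel[OF M])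
qed

text \<open>
  Multiplication by \<open>X\<close> loses at most as much on the image of \<open>Y * Z\<close> as on the larger image of
  \<open>Y\<close>.
\<close>

lemma frobenius_rank_inequality:
  fixes X Y Z :: "'a :: {finite, field} mat"
  assumes X: "X \<in> carrier_mat a b" and Y: "Y \<in> carrier_mat b c" and Z: "Z \<in> carrier_mat c d"
  shows "mat_rank (X * Y) + mat_rank (Y * Z) \<le> mat_rank Y + mat_rank (X * (Y * Z))"
proof -
  let ?Q = "CARD('a)"
  let ?k = "card (mat_image Y \<inter> mat_kernel X)" and ?l = "card (mat_image (Y * Z) \<inter> mat_kernel X)"
  have YZ: "Y * Z \<in> carrier_mat b d" using Y Z by simp
  have "mat_image (Y * Z) \<subseteq> mat_image Y"
    using Y Z by (auto simp: mat_image_mult[OF Y Z] mat_image_def)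
  then have lk: "?l \<le> ?k"
    using finite_subset[OF mat_image_subset[OF Y]] by (intro card_mono) auto
  have 1: "card (mat_image M) = card (mat_image (X * M)) * card (mat_image M \<inter> mat_kernel X)"
    if "M \<in> carrier_mat b e" for M e
    using card_subspace_eq[OF X mat_image_subset[OF that] mat_image_add]
    by (simp add: mat_image_mult[OF X that])
  have "?Q ^ (mat_rank (X * Y) + mat_rank (Y * Z)) =
      ?Q ^ mat_rank (X * Y) * (?Q ^ mat_rank (X * (Y * Z)) * ?l)"
    using 1[OF YZ] by (simp add: card_mat_image power_add)
  also have "\<dots> \<le> ?Q ^ mat_rank (X * Y) * (?Q ^ mat_rank (X * (Y * Z)) * ?k)"
    using lk by simp
  also have "\<dots> = ?Q ^ (mat_rank Y + mat_rank (X * (Y * Z)))"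
    using 1[OF Y] by (simp add: card_mat_image power_add mult_ac)
  finally show ?thesis using card_field_ge_2[where 'a = 'a] by simp
qed

lemma card_orthogonal_vectors:
  fixes w :: "'a :: {finite, field} vec"
  assumes w: "w \<in> carrier_vec n"
  shows "CARD('a) * card {y \<in> carrier_vec n. y \<bullet> w = 0} =
    (if w = 0\<^sub>v n then CARD('a) * CARD('a) ^ n else CARD('a) ^ n)"
proof (cases "w = 0\<^sub>v n")
  case True
  then have "{y \<in> carrier_vec n. y \<bullet> w = 0} = (carrier_vec n :: 'a vec set)" by auto
  then show ?thesis using True by (simp add: card_carrier_vec)
next
  case False
  then obtain i where i: "i < n" "w $ i \<noteq> 0" using w by (metis carrier_vecD eq_vecI index_zero_vec)
  let ?K = "{y \<in> carrier_vec n. y \<bullet> w = 0}"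
  have "card (carrier_vec n :: 'a vec set) = card ((\<lambda>y. y \<bullet> w) ` carrier_vec n) * card ?K"
  proof (rule card_eq_card_image_times_kernel[where n = n])
    fix x y :: "'a vec" assume "x \<in> carrier_vec n" "y \<in> carrier_vec n"
    then show "x \<bullet> w = y \<bullet> w \<longleftrightarrow> y - x \<in> ?K"
      using w minus_scalar_prod_distrib[of y n x w] by auto
  qed auto
  moreover have "(\<lambda>y. y \<bullet> w) ` carrier_vec n = (UNIV :: 'a set)"
  proof -
    have "z \<in> (\<lambda>y. y \<bullet> w) ` carrier_vec n" for z
    proof (rule image_eqI)
      show "z = ((z / w $ i) \<cdot>\<^sub>v unit_vec n i) \<bullet> w"
        using w i by (simp add: scalar_prod_left_unit)
    qed simp
    then show ?thesis by auto
  qed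
  ultimately show ?thesis using False by (simp add: card_carrier_vec)
qed

text \<open>
  Counting the pairs \<open>(x, y)\<close> with \<open>y \<bullet> M x = 0\<close> by \<open>x\<close>: all \<open>y\<close> qualify if \<open>x\<close> is in the
  kernel, and a fraction \<open>1 / Q\<close> of them otherwise. The equation is arranged so that no
  subtraction is needed.
\<close>

lemma card_vanishing_pairs:
  fixes M :: "'a :: {finite, field} mat"
  assumes M: "M \<in> carrier_mat m n"
  defines "Q \<equiv> CARD('a)"
  shows "Q * (\<Sum>x\<in>carrier_vec n. card {y \<in> carrier_vec m. y \<bullet> (M *\<^sub>v x) = 0}) + Q ^ (m + kernel_dim M)
    = Q * Q ^ (m + kernel_dim M) + Q ^ (m + n)"
proof -
  let ?C = "carrier_vec n :: 'a vec set" and ?K = "mat_kernel M"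
  have K: "?K \<subseteq> ?C" using mat_kernel_carrier[OF M] .
  have cK: "card ?K = Q ^ kernel_dim M" by (simp add: Q_def card_mat_kernel[OF M])
  have cC: "card (?C - ?K) + Q ^ kernel_dim M = Q ^ n"
    using card_Diff_subset[OF finite_subset[OF K] K] card_mono[OF _ K] cK
    by (simp add: card_carrier_vec Q_def)
  have "Q * (\<Sum>x\<in>?C. card {y \<in> carrier_vec m. y \<bullet> (M *\<^sub>v x) = 0}) =
      (\<Sum>x\<in>?C. if x \<in> ?K then Q * Q ^ m else Q ^ m)"
    unfolding sum_distrib_left
  proof (rule sum.cong[OF refl])
    fix x assume x: "x \<in> ?C"
    have "M *\<^sub>v x \<in> carrier_vec m" using M x by simp
    from card_orthogonal_vectors[OF this] x
    show "Q * card {y \<in> carrier_vec m. y \<bullet> (M *\<^sub>v x) = 0} = (if x \<in> ?K then Q * Q ^ m else Q ^ m)"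
      unfolding Q_def mat_kernel[OF M] by simp
  qed
  also have "\<dots> = card ?K * (Q * Q ^ m) + card (?C - ?K) * Q ^ m"
    using K by (simp add: sum.If_cases Int_absorb1 Diff_eq)
  finally have "Q * (\<Sum>x\<in>?C. card {y \<in> carrier_vec m. y \<bullet> (M *\<^sub>v x) = 0}) + Q ^ m * Q ^ kernel_dim M =
      Q ^ kernel_dim M * (Q * Q ^ m) + (card (?C - ?K) + Q ^ kernel_dim M) * Q ^ m"
    unfolding cK by (simp only: distrib_right mult.commute[of "Q ^ m"] add.assoc)
  then show ?thesis unfolding cC by (simp add: power_add mult_ac)
qed

text \<open>
  The pairs \<open>(x, y)\<close> with \<open>y \<bullet> M x = 0\<close> can be counted by \<open>x\<close> or by \<open>y\<close>; comparing the two
  counts relates the kernels of \<open>M\<close> and of its transpose.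
\<close>

lemma mat_rank_transpose:
  fixes M :: "'a :: {finite, field} mat"
  assumes M: "M \<in> carrier_mat m n"
  shows "mat_rank (transpose_mat M) = mat_rank M"
proof -
  let ?Q = "CARD('a)" and ?T = "transpose_mat M"
  have T: "?T \<in> carrier_mat n m" using M by simp
  have "(\<Sum>x\<in>carrier_vec n. card {y \<in> carrier_vec m. y \<bullet> (M *\<^sub>v x) = 0}) =
        (\<Sum>x\<in>carrier_vec n. \<Sum>y\<in>carrier_vec m. if y \<bullet> (M *\<^sub>v x) = 0 then 1 else 0)"
    by (simp add: sum.If_cases Int_def)
  also have "\<dots> = (\<Sum>y\<in>carrier_vec m. \<Sum>x\<in>carrier_vec n. if x \<bullet> (?T *\<^sub>v y) = 0 then 1 else 0)"
  proof (subst sum.swap, intro sum.cong refl)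
    fix x y :: "'a vec" assume x: "x \<in> carrier_vec n" and y: "y \<in> carrier_vec m"
    have "y \<bullet> (M *\<^sub>v x) = x \<bullet> (?T *\<^sub>v y)"
      using transpose_vec_mult_scalar[OF M x y] x y M by (simp add: comm_scalar_prod[of _ n])
    then show "(if y \<bullet> (M *\<^sub>v x) = 0 then 1 else 0 :: nat) = (if x \<bullet> (?T *\<^sub>v y) = 0 then 1 else 0)"
      by simp
  qed
  also have "\<dots> = (\<Sum>x\<in>carrier_vec m. card {y \<in> carrier_vec n. y \<bullet> (?T *\<^sub>v x) = 0})"
    by (simp add: sum.If_cases Int_def)
  finally have eq: "(\<Sum>x\<in>carrier_vec n. card {y \<in> carrier_vec m. y \<bullet> (M *\<^sub>v x) = 0}) =
    (\<Sum>x\<in>carrier_vec m. card {y \<in> carrier_vec n. y \<bullet> (?T *\<^sub>v x) = 0})" .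
  let ?A = "?Q ^ (m + kernel_dim M)" and ?B = "?Q ^ (n + kernel_dim ?T)"
  have "?Q * ?A + ?B = ?Q * ?B + ?A"
    using card_vanishing_pairs[OF M] card_vanishing_pairs[OF T] unfolding eq
    by (simp add: add.commute)
  then have "(?Q - 1) * ?A = (?Q - 1) * ?B"
    by (simp add: diff_mult_distrib)
  then have "?A = ?B" using card_field_ge_2[where 'a = 'a] by simp
  then have "m + kernel_dim M = n + kernel_dim ?T"
    using card_field_ge_2[where 'a = 'a] by (subst (asm) power_inject_exp) auto
  then show ?thesis using M kernel_dim_le[OF M] kernel_dim_le[OF T] by (simp add: mat_rank_def)
qed


section \<open>Jordan types of nilpotent matrices\<close>

lemma invertible_with_first_column:
  fixes v :: "'a :: field vec"
  assumes v: "v \<in> carrier_vec n" "v \<noteq> 0\<^sub>v n" and n: "0 < n"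
  obtains W W' where "W \<in> carrier_mat n n" "W' \<in> carrier_mat n n"
    "W * W' = 1\<^sub>m n" "W' * W = 1\<^sub>m n" "col W 0 = v"
proof -
  interpret vec_space "TYPE('a)" n .
  define b where "b = basis_completion v"
  define W where "W = mat_of_cols n b"
  note b = basis_completion[OF v, folded b_def]
  have W: "W \<in> carrier_mat n n" unfolding W_def using b(6) mat_of_cols_carrier(1)[of n b] by simp
  have cols: "cols W = b" unfolding W_def using b(2) by (rule cols_mat_of_cols)
  have "rank W = n" using lin_indpt_full_rank[OF W] b(4,5) cols by simp
  then have "det W \<noteq> 0" using det_rank_iff[OF W] by simp
  from det_non_zero_imp_unit[OF W this, unfolded Units_def, of "()"]
  obtain W' where W': "W' \<in> carrier_mat n n" "W' * W = 1\<^sub>m n" "W * W' = 1\<^sub>m n"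
    by (auto simp: ring_mat_def)
  have "col W 0 = b ! 0" unfolding W_def using b(2,6) n by (intro col_mat_of_cols) auto
  also have "\<dots> = v" using b(6,7) n by (metis hd_conv_nth list.size(3) less_irrefl)
  finally show ?thesis using that W W' by blast
qed

lemma nilpotent_singular:
  fixes N :: "'a :: field mat"
  assumes N: "N \<in> carrier_mat n n" and nil: "N ^\<^sub>m k = 0\<^sub>m n n" and n: "0 < n"
  obtains v where "v \<in> carrier_vec n" "v \<noteq> 0\<^sub>v n" "N *\<^sub>v v = 0\<^sub>v n"
proof -
  have "det (N ^\<^sub>m k) = det N ^ k" for k
    by (induction k) (use N in \<open>auto simp: det_mult[of _ n]\<close>)
  moreover have "det (0\<^sub>m n n :: 'a mat) = 0" 
    unfolding det_0_iff_vec_prod_zero_field[OF zero_carrier_mat]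
    using n by (intro exI[of _ "unit_vec n 0"]) auto
  ultimately have "det N = 0" using nil by (metis power_not_zero)
  then show ?thesis using that det_0_iff_vec_prod_zero_field[OF N] by blast
qed

lemma pow_mat_block_upper_triangular:
  fixes B :: "'a :: field mat"
  assumes A: "A \<in> carrier_mat n n" and C: "C \<in> carrier_mat n m" and B: "B \<in> carrier_mat m m"
  shows "\<exists>X\<in>carrier_mat n n. \<exists>Y\<in>carrier_mat n m.
    four_block_mat A C (0\<^sub>m m n) B ^\<^sub>m k = four_block_mat X Y (0\<^sub>m m n) (B ^\<^sub>m k)"
proof (induction k)
  case 0
  have "four_block_mat A C (0\<^sub>m m n) B ^\<^sub>m 0 = four_block_mat (1\<^sub>m n) (0\<^sub>m n m) (0\<^sub>m m n) (1\<^sub>m m)"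
    using A B by simp
  then show ?case using B one_carrier_mat zero_carrier_mat by (metis carrier_matD(1) pow_mat.simps(1))
next
  case (Suc k)
  then obtain X Y where XY: "X \<in> carrier_mat n n" "Y \<in> carrier_mat n m"
    and eq: "four_block_mat A C (0\<^sub>m m n) B ^\<^sub>m k = four_block_mat X Y (0\<^sub>m m n) (B ^\<^sub>m k)" by blast
  have Bk: "B ^\<^sub>m k \<in> carrier_mat m m" using B by simp
  have "four_block_mat A C (0\<^sub>m m n) B ^\<^sub>m Suc k = four_block_mat (X * A) (X * C + Y * B) (0\<^sub>m m n) (B ^\<^sub>m Suc k)"
    using XY A B C Bk left_add_zero_mat[OF mult_carrier_mat[OF Bk B]]
    by (simp add: eq mult_four_block_mat[OF XY zero_carrier_mat Bk A C zero_carrier_mat B])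
  then show ?case using XY A B C by (metis add_carrier_mat mult_carrier_mat)
qed

text \<open>
  Choose a kernel vector as first vector of a basis; the matrix acts on the quotient by a nilpotent
  matrix of smaller size.
\<close>

lemma nilpotent_triangularizable:
  fixes N :: "'a :: field mat"
  assumes "N \<in> carrier_mat n n" and "N ^\<^sub>m k = 0\<^sub>m n n"
  shows "\<exists>B\<in>carrier_mat n n. upper_triangular B \<and> similar_mat N B"
  using assms
proof (induction n arbitrary: N)
  case 0
  then show ?case using similar_mat_refl by (auto intro!: bexI[of _ N])
next
  case (Suc m)
  let ?n = "Suc m"
  note N = Suc.prems(1)
  obtain v where v: "v \<in> carrier_vec ?n" "v \<noteq> 0\<^sub>v ?n" "N *\<^sub>v v = 0\<^sub>v ?n"
    using nilpotent_singular[OF Suc.prems] by auto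
  obtain W W' where W: "W \<in> carrier_mat ?n ?n" and W': "W' \<in> carrier_mat ?n ?n"
    and inv: "W * W' = 1\<^sub>m ?n" "W' * W = 1\<^sub>m ?n" and col: "col W 0 = v"
    using invertible_with_first_column[OF v(1,2)] by blast
  define M where "M = W' * N * W"
  have M: "M \<in> carrier_mat ?n ?n" using W W' N by (simp add: M_def)
  have wit: "similar_mat_wit M N W' W"
    by (rule similar_mat_witI[OF inv(2,1) M_def M N W' W])
  have M0: "M $$ (i, 0) = 0" if "i < ?n" for i
  proof -
    have "M = W' * (N * W)" using W W' N by (simp add: M_def)
    then have "col M 0 = W' *\<^sub>v col (N * W) 0" using W' W N by (simp add: col_mult2[OF W', of _ ?n])
    also have "col (N * W) 0 = 0\<^sub>v ?n" using col_mult2[OF N W, of 0] col v(3) by simp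
    also have "W' *\<^sub>v 0\<^sub>v ?n = 0\<^sub>v ?n" using W' by auto
    finally show ?thesis using that M by (metis carrier_matD index_col index_zero_vec(1) zero_less_Suc)
  qed
  define R where "R = mat 1 m (\<lambda>(i, j). M $$ (0, Suc j))"
  define B where "B = mat m m (\<lambda>(i, j). M $$ (Suc i, Suc j))"
  have R: "R \<in> carrier_mat 1 m" and B: "B \<in> carrier_mat m m" by (simp_all add: R_def B_def)
  have block: "M = four_block_mat (0\<^sub>m 1 1) R (0\<^sub>m m 1) B"
    using M M0 by (intro eq_matI) (auto simp: R_def B_def)
  have "B ^\<^sub>m k = 0\<^sub>m m m"
  proof -
    obtain X Y where XY: "X \<in> carrier_mat 1 1" "Y \<in> carrier_mat 1 m"
      and eq: "M ^\<^sub>m k = four_block_mat X Y (0\<^sub>m m 1) (B ^\<^sub>m k)"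
      using pow_mat_block_upper_triangular[OF zero_carrier_mat R B] block by blast
    have "M ^\<^sub>m k = 0\<^sub>m ?n ?n"
      using similar_mat_wit_pow_id[OF wit, of k] W W' Suc.prems(2) by simp
    then have z: "four_block_mat X Y (0\<^sub>m m 1) (B ^\<^sub>m k) $$ (Suc i, Suc j) = 0" if "i < m" "j < m" for i j
      using that \<open>M ^\<^sub>m k = 0\<^sub>m ?n ?n\<close> unfolding eq[symmetric] by simp
    have Bk: "B ^\<^sub>m k \<in> carrier_mat m m" using B by simp
    have "(B ^\<^sub>m k) $$ (i, j) = 0" if "i < m" "j < m" for i j
      using z[OF that] that carrier_matD[OF XY(1)] carrier_matD[OF Bk] by simp
    then show ?thesis using Bk by (intro eq_matI) auto
  qed
  then obtain T where T: "T \<in> carrier_mat m m" "upper_triangular T" and BT: "similar_mat B T"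
    using Suc.IH[OF B] by blast
  obtain S where S: "S \<in> carrier_mat 1 m"
    and sim: "similar_mat M (four_block_mat (0\<^sub>m 1 1) S (0\<^sub>m m 1) T)"
    using similar_mat_four_block_0_ex[OF similar_mat_refl[OF zero_carrier_mat] BT R zero_carrier_mat B] block by blast
  have "similar_mat N M" using wit similar_mat_sym unfolding similar_mat_def by blast
  then have "similar_mat N (four_block_mat (0\<^sub>m 1 1) S (0\<^sub>m m 1) T)" using sim by (rule similar_mat_trans)
  moreover have "upper_triangular (four_block_mat (0\<^sub>m 1 1) S (0\<^sub>m m 1) T)"
    by (rule upper_triangular_four_block[OF zero_carrier_mat T(1) _ T(2)]) auto
  moreover have "four_block_mat (0\<^sub>m 1 1) S (0\<^sub>m m 1) T \<in> carrier_mat ?n ?n"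
    using T(1) four_block_carrier_mat[OF zero_carrier_mat[of 1 1] T(1)] by simp
  ultimately show ?case by blast
qed

text \<open>
  A triangular matrix over any field has a Jordan normal form. A block with eigenvalue \<open>a\<close> yields
  an eigenvector, on which the vanishing power acts as a power of \<open>a\<close>.
\<close>

lemma nilpotent_jordan_nf:
  fixes N :: "'a :: field mat"
  assumes N: "N \<in> carrier_mat n n" and nil: "N ^\<^sub>m k = 0\<^sub>m n n"
  obtains ls where "jordan_nf N (map (\<lambda>l. (l, 0)) ls)"
proof -
  obtain B where B: "B \<in> carrier_mat n n" "upper_triangular B" and sim: "similar_mat N B"
    using nilpotent_triangularizable[OF assms] by blast
  from triangular_to_jnf_vector[OF B] obtain n_as where "jordan_nf B n_as" by blast
  then have nf: "jordan_nf N n_as" using sim similar_mat_trans unfolding jordan_nf_def by blast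
  have ev0: "a = 0" if la: "(l, a) \<in> set n_as" for l a
  proof -
    have "l \<noteq> 0" using nf la unfolding jordan_nf_def by force
    then have "poly (char_poly N) a = 0"
      unfolding jordan_nf_char_poly[OF nf] poly_prod_list prod_list_zero_iff using la
      by (force simp: poly_power)
    then have "eigenvalue N a" using eigenvalue_root_char_poly[OF N] by simp
    then obtain v where ev: "eigenvector N v a" unfolding eigenvalue_def by blast
    then have v: "v \<in> carrier_vec n" "v \<noteq> 0\<^sub>v n" using N unfolding eigenvector_def by auto
    have "0\<^sub>m n n *\<^sub>v v = 0\<^sub>v n" using v by (intro eq_vecI) auto
    then have "a ^ k \<cdot>\<^sub>v v = 0\<^sub>v n" using eigenvector_pow[OF N ev, of k] nil by simp
    then have "a ^ k = 0" using v
      by (metis (no_types, lifting) carrier_vecD eq_vecI index_smult_vec(1) index_zero_vec mult_eq_0_iff)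
    then show ?thesis by simp
  qed
  have "map (\<lambda>l. (l, 0)) (map fst n_as) = n_as"
    using ev0 by (force simp: o_def intro!: map_idI)
  then show ?thesis using that[of "map fst n_as"] nf by simp
qed

lemma mu_nilpotent:
  assumes "jordan_nf N (map (\<lambda>l. (l, 0)) ls)"
  shows "mu N = rev (sort ls)"
  using mu_eq[OF assms] by (simp add: o_def)

lemma jordan_nf_imp_nilpotent:
  fixes N :: "'a :: field mat"
  assumes nf: "jordan_nf N (map (\<lambda>l. (l, 0)) ls)"
  shows "nilpotent_mat N"
proof -
  let ?s = "sum_list ls"
  let ?J = "jordan_matrix (map (\<lambda>l. (l, 0 :: 'a)) ls)"
  have block: "jordan_block l (0 :: 'a) ^\<^sub>m k = 0\<^sub>m l l" if "l \<le> k" for l k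
    using that unfolding jordan_block_zero_pow by (intro eq_matI) auto
  have diag: "diag_block_mat (map (\<lambda>l. 0\<^sub>m l l) xs) = (0\<^sub>m (sum_list xs) (sum_list xs) :: 'a mat)" for xs
    by (induction xs) (auto simp: Let_def)
  have bl: "jordan_block l (0 :: 'a) ^\<^sub>m ?s = 0\<^sub>m l l" if "l \<in> set ls" for l
      using member_le_sum_list[OF that] by (intro block) simp
  have "map (\<lambda>(n, a). jordan_block n a ^\<^sub>m ?s) (map (\<lambda>l. (l, 0 :: 'a)) ls) = map (\<lambda>l. 0\<^sub>m l l) ls"
    unfolding map_map o_def split by (rule map_cong[OF refl]) (rule bl)
  then have "?J ^\<^sub>m ?s = diag_block_mat (map (\<lambda>l. 0\<^sub>m l l) ls)"
    unfolding jordan_matrix_pow by (rule arg_cong)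
  then have J: "?J ^\<^sub>m ?s = 0\<^sub>m ?s ?s" unfolding diag .
  have "similar_mat N ?J" using nf unfolding jordan_nf_def by blast
  then obtain P Q where wit: "similar_mat_wit N ?J P Q" unfolding similar_mat_def by blast
  from similar_mat_witD[OF refl wit]
  have c: "N \<in> carrier_mat (dim_row N) (dim_row N)" "?J \<in> carrier_mat (dim_row N) (dim_row N)"
    "P \<in> carrier_mat (dim_row N) (dim_row N)" "Q \<in> carrier_mat (dim_row N) (dim_row N)" by blast+
  have s: "?s = dim_row N" using carrier_matD(1)[OF c(2)] by (simp add: o_def)
  have "N ^\<^sub>m ?s = 0\<^sub>m (dim_row N) (dim_row N)"
    using similar_mat_wit_pow_id[OF wit, of ?s, unfolded J] c(3,4) by (simp add: s)
  then show ?thesis unfolding nilpotent_mat_def using carrier_matD[OF c(1)]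
    by (intro conjI exI[of _ ?s]) simp_all
qed

lemma kernel_dim_nilpotent_power:
  fixes N :: "'a :: field mat"
  assumes N: "N \<in> carrier_mat n n" and nil: "nilpotent_mat N"
  shows "kernel_dim (N ^\<^sub>m k) = (\<Sum>l\<leftarrow>mu N. min k l)"
proof -
  obtain j where "N ^\<^sub>m j = 0\<^sub>m n n" using N nil unfolding nilpotent_mat_def by auto
  then obtain ls where nf: "jordan_nf N (map (\<lambda>l. (l, 0)) ls)" using nilpotent_jordan_nf[OF N] by blast
  have "char_matrix N 0 = N" using N by (intro eq_matI) (auto simp: char_matrix_def)
  then have "kernel_dim (N ^\<^sub>m k) = dim_gen_eigenspace N 0 k" by (simp add: dim_gen_eigenspace_def)
  also have "\<dots> = (\<Sum>l\<leftarrow>ls. min k l)"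
    unfolding dim_gen_eigenspace[OF nf] by (induction ls) auto
  also have "\<dots> = (\<Sum>l\<leftarrow>mu N. min k l)"
  proof -
    have "mset (map (min k) (mu N)) = mset (map (min k) ls)" by (simp add: mu_nilpotent[OF nf])
    then show ?thesis by (metis sum_mset_sum_list)
  qed
  finally show ?thesis .
qed

lemma sum_min_Suc: "(\<Sum>l\<leftarrow>ls. min (Suc k) l) = (\<Sum>l\<leftarrow>ls. min k l) + conj_part ls (Suc k)"
  by (induction ls) (auto simp: conj_part_def)

text \<open>
  Passing from the \<open>k\<close>-th power to the next one lowers the rank by one in each Jordan block of size
  greater than \<open>k\<close>.
\<close>

lemma conj_part_mu:
  fixes N :: "'a :: {finite, field} mat"
  assumes N: "N \<in> carrier_mat n n" and nil: "nilpotent_mat N"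
  shows "mat_rank (N ^\<^sub>m k) = mat_rank (N ^\<^sub>m Suc k) + conj_part (mu N) (Suc k)"
proof -
  have c: "N ^\<^sub>m j \<in> carrier_mat n n" for j using N by simp
  have "mat_rank (N ^\<^sub>m j) + (\<Sum>l\<leftarrow>mu N. min j l) = n" for j
  proof -
    have "dim_col (N ^\<^sub>m j) = n" using c[of j] by (rule carrier_matD)
    then show ?thesis
      using kernel_dim_le[OF c[of j]] by (simp only: mat_rank_def kernel_dim_nilpotent_power[OF assms])
  qed
  from this[of k] this[of "Suc k"] show ?thesis by (simp only: sum_min_Suc)
qed

lemma pow_mat_Suc_left:
  fixes A :: "'a :: semiring_1 mat"
  assumes A: "A \<in> carrier_mat n n"
  shows "A ^\<^sub>m Suc k = A * A ^\<^sub>m k"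
proof (induction k)
  case (Suc k)
  have "A ^\<^sub>m Suc (Suc k) = (A * A ^\<^sub>m k) * A" using Suc.IH by simp
  then show ?case using A by (simp add: assoc_mult_mat[of _ n n _ n _ n])
qed (use A in simp)

lemma pow_mult_swap:
  fixes A :: "'a :: semiring_1 mat"
  assumes A: "A \<in> carrier_mat m n" and B: "B \<in> carrier_mat n m"
  shows "(A * B) ^\<^sub>m k * A = A * (B * A) ^\<^sub>m k"
proof (induction k)
  case (Suc k)
  have c: "A * B \<in> carrier_mat m m" "B * A \<in> carrier_mat n n" "(A * B) ^\<^sub>m k \<in> carrier_mat m m"
    "(B * A) ^\<^sub>m k \<in> carrier_mat n n" using A B by auto
  have "(A * B) ^\<^sub>m Suc k * A = (A * B) ^\<^sub>m k * A * (B * A)"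
    using assoc_mult_mat[OF c(3,1) A] assoc_mult_mat[OF A B A] assoc_mult_mat[OF c(3) A c(2)] by simp
  then show ?case using Suc.IH assoc_mult_mat[OF A c(4,2)] by simp
qed (use A B in simp)

lemma nilpotent_swap:
  assumes A: "A \<in> carrier_mat m n" and B: "B \<in> carrier_mat n m" and nil: "nilpotent_mat (A * B)"
  shows "nilpotent_mat (B * A)"
proof -
  obtain k where k: "(A * B) ^\<^sub>m k = 0\<^sub>m m m" using nil A B unfolding nilpotent_mat_def by auto
  have c: "(B * A) ^\<^sub>m k \<in> carrier_mat n n" using A B by simp
  have "(B * A) ^\<^sub>m Suc k = (B * A) ^\<^sub>m k * B * A"
    using assoc_mult_mat[OF c B A] by simp
  also have "\<dots> = 0\<^sub>m n n" using A B by (simp add: pow_mult_swap[OF B A] k)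
  finally show ?thesis using A B unfolding nilpotent_mat_def by (auto intro!: exI[of _ "Suc k"])
qed

text \<open>
  The products are the powers of the operator \<open>T = A \<oplus> B\<close> that exchanges two spaces, restricted to
  one of them. Frobenius's inequality says that the numbers of strings of \<open>T\<close> with a prescribed
  end space and a prescribed length, expressed by ranks, are not negative.
\<close>

lemma rank_word_inequalities:
  fixes A B :: "'a :: {finite, field} mat"
  assumes A: "A \<in> carrier_mat m n" and B: "B \<in> carrier_mat n m"
  shows "mat_rank (A * (B * A) ^\<^sub>m j) + mat_rank (B * (A * B) ^\<^sub>m j)
      \<le> mat_rank ((B * A) ^\<^sub>m j) + mat_rank ((A * B) ^\<^sub>m Suc j)" (is ?one)
    and "mat_rank ((B * A) ^\<^sub>m Suc j) + mat_rank ((A * B) ^\<^sub>m Suc j)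
      \<le> mat_rank (A * (B * A) ^\<^sub>m j) + mat_rank (B * (A * B) ^\<^sub>m Suc j)" (is ?two)
proof -
  have AB: "A * B \<in> carrier_mat m m" and BA: "B * A \<in> carrier_mat n n" using A B by auto
  have ABj: "(A * B) ^\<^sub>m j \<in> carrier_mat m m" and BAj: "(B * A) ^\<^sub>m j \<in> carrier_mat n n" for j
    using AB BA by auto
  have 1: "A * (B * (A * B) ^\<^sub>m j) = (A * B) ^\<^sub>m Suc j" for j
    using A B ABj[of j] by (simp only: pow_mat_Suc_left[OF AB] assoc_mult_mat[OF A B ABj])
  have 2: "B * (A * (B * A) ^\<^sub>m j) = (B * A) ^\<^sub>m Suc j" for j
    using A B BAj[of j] by (simp only: pow_mat_Suc_left[OF BA] assoc_mult_mat[OF B A BAj])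
  show ?one
    using frobenius_rank_inequality[OF A BAj B, of j] by (simp only: pow_mult_swap[OF B A] 1)
  have 3: "A * (B * A) ^\<^sub>m j * B = (A * B) ^\<^sub>m Suc j"
    using assoc_mult_mat[OF A BAj B] by (simp only: pow_mult_swap[OF B A] 1)
  have "A * (B * A) ^\<^sub>m j \<in> carrier_mat m n" using A BAj[of j] by simp
  from frobenius_rank_inequality[OF B this B] show ?two by (simp only: 2 3)
qed

text \<open>
  The multiplicity \<open>k\<close> of a part is the second difference of \<open>R0\<close>, \<open>R1\<close>, \<open>R2\<close>, the ranks of three
  consecutive powers; the ranks \<open>S1\<close>, \<open>p\<close>, \<open>p'\<close> of the words in between cancel.
\<close>

lemma second_difference:
  fixes u d e p p' :: nat
  assumes "u + 2 * p = R0 + S1" "d + 2 * p' = S1 + R2" "e + 2 * (R1 + S1) = 2 * (p + p')"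
    and "R0 = R1 + (c + k)" "R1 = R2 + c"
  shows "k = u + d + e"
proof -
  have "(u + 2 * p) + (d + 2 * p') + (e + 2 * (R1 + S1)) = (R0 + S1) + (S1 + R2) + 2 * (p + p')"
    by (simp only: assms(1-3))
  then have "u + d + e + 2 * R1 = R0 + R2" by simp
  then show ?thesis using assms(4,5) by simp
qed

text \<open>
  Here \<open>u r\<close> and \<open>d r\<close> are the numbers of strings of odd length \<open>2 * r + 1\<close> of either kind. The
  numbers of strings of length \<open>2 * r + 2\<close> starting in one space or in the other are both equal to
  \<open>P r + P (Suc r) - R (Suc r) - S (Suc r)\<close>, because by duality \<open>P\<close> does not depend on the space in
  which the word starts. Hence their total \<open>e r\<close> is even.
\<close>

lemma matchable_mu:
  fixes A B :: "'a :: {finite, field} mat"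
  assumes A: "A \<in> carrier_mat m n" and B: "B \<in> carrier_mat n m" and nil: "nilpotent_mat (A * B)"
    and dual: "\<And>j. mat_rank (B * (A * B) ^\<^sub>m j) = mat_rank (A * (B * A) ^\<^sub>m j)"
  shows "matchable (mu (A * B)) (mu (B * A))"
proof -
  define R where "R j = mat_rank ((A * B) ^\<^sub>m j)" for j
  define S where "S j = mat_rank ((B * A) ^\<^sub>m j)" for j
  define P where "P j = mat_rank (A * (B * A) ^\<^sub>m j)" for j
  have AB: "A * B \<in> carrier_mat m m" and BA: "B * A \<in> carrier_mat n n" using A B by auto
  have 1: "2 * P j \<le> S j + R (Suc j)" for j
    using rank_word_inequalities(1)[OF A B, of j] by (simp add: P_def S_def R_def dual)
  have 2: "2 * P j \<le> R j + S (Suc j)" for j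
    using rank_word_inequalities(1)[OF B A, of j] by (simp add: P_def S_def R_def dual)
  have 3: "R (Suc j) + S (Suc j) \<le> P j + P (Suc j)" for j
    using rank_word_inequalities(2)[OF A B, of j] unfolding P_def S_def R_def dual by linarith
  have a: "R j = R (Suc j) + (conj_part (mu (A * B)) (Suc (Suc j)) + count (mset (mu (A * B))) (Suc j))"
    and a': "R (Suc j) = R (Suc (Suc j)) + conj_part (mu (A * B)) (Suc (Suc j))" for j
    using conj_part_mu[OF AB nil] conj_part_Suc[of "mu (A * B)" "Suc j"] unfolding R_def by metis+
  note nil' = nilpotent_swap[OF A B nil]
  have b: "S j = S (Suc j) + (conj_part (mu (B * A)) (Suc (Suc j)) + count (mset (mu (B * A))) (Suc j))"
    and b': "S (Suc j) = S (Suc (Suc j)) + conj_part (mu (B * A)) (Suc (Suc j))" for j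
    using conj_part_mu[OF BA nil'] conj_part_Suc[of "mu (B * A)" "Suc j"] unfolding S_def by metis+
  define u where "u r = R r + S (Suc r) - 2 * P r" for r
  define d where "d r = S r + R (Suc r) - 2 * P r" for r
  define e where "e r = 2 * (P r + P (Suc r) - R (Suc r) - S (Suc r))" for r
  show ?thesis
    unfolding matchable_def
  proof (intro exI allI conjI)
    fix r
    show "even (e r)" by (simp add: e_def)
    have u: "u r + 2 * P r = R r + S (Suc r)" "u (Suc r) + 2 * P (Suc r) = R (Suc r) + S (Suc (Suc r))"
      using 2[of r] 2[of "Suc r"] by (auto simp: u_def)
    have d: "d r + 2 * P r = S r + R (Suc r)" "d (Suc r) + 2 * P (Suc r) = S (Suc r) + R (Suc (Suc r))"
      using 1[of r] 1[of "Suc r"] by (auto simp: d_def)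
    have e: "e r + 2 * (R (Suc r) + S (Suc r)) = 2 * (P r + P (Suc r))"
      using 3[of r] by (auto simp: e_def)
    show "count (mset (mu (A * B))) (Suc r) = u r + d (Suc r) + e r"
      by (rule second_difference[OF u(1) d(2) e a a'])
    show "count (mset (mu (B * A))) (Suc r) = d r + u (Suc r) + e r"
      by (rule second_difference[OF d(1) u(2) _ b b']) (use e in \<open>simp add: add.commute\<close>)
  qed
qed


section \<open>The conjugate transpose over a field of square order\<close>

text \<open>
  The setting of Hermitian forms: \<open>x \<mapsto> x ^ q\<close> is the involution of the field with \<open>q ^ 2\<close>
  elements.
\<close>

locale hermitian_field =
  fixes q :: nat and ty :: "'a :: {finite, field} itself"
  assumes primepow_q: "primepow q" and card_field: "CARD('a) = q ^ 2"
begin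

lemma q_ge_2: "q \<ge> 2"
  using primepow_gt_Suc_0[OF primepow_q] by simp

lemma q_power_of_char: "prime CHAR('a)" "\<exists>k. q = CHAR('a) ^ k"
proof -
  have "CHAR('a) > 0" by (rule finite_imp_CHAR_pos) simp
  then show p: "prime CHAR('a)" by (rule prime_CHAR_semidom)
  obtain p k where pk: "prime p" "q = p ^ k" using primepow_q unfolding primepow_def by blast
  have "CHAR('a) dvd q ^ 2" using CHAR_dvd_CARD[where 'a = 'a] card_field by simp
  then have "CHAR('a) dvd q" using p prime_dvd_power by blast
  then have "CHAR('a) dvd p" unfolding pk using p prime_dvd_power by blast
  then have "CHAR('a) = p" using p pk(1) primes_dvd_imp_eq by blast
  then show "\<exists>k. q = CHAR('a) ^ k" using pk by blast
qed

lemma conj_add: "(x + y :: 'a) ^ q = x ^ q + y ^ q"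
  using q_power_of_char freshmans_dream' by blast

lemma power_card_minus_1:
  assumes "x \<noteq> (0 :: 'a)"
  shows "x ^ (q ^ 2 - 1) = 1"
proof -
  have "(\<Prod>y\<in>UNIV - {0}. x * y) = \<Prod>(UNIV - {0} :: 'a set)"
    by (rule prod.reindex_bij_witness[of _ "\<lambda>y. y / x" "\<lambda>y. x * y"]) (use assms in auto)
  then have "x ^ card (UNIV - {0} :: 'a set) * \<Prod>(UNIV - {0}) = \<Prod>(UNIV - {0})"
    by (simp add: prod.distrib)
  moreover have "\<Prod>(UNIV - {0} :: 'a set) \<noteq> 0" by simp
  ultimately show ?thesis by (simp add: card_Diff_subset card_field)
qed

lemma conj_conj: "(x ^ q) ^ q = (x :: 'a)"
proof (cases "x = 0")
  case False
  have "q ^ 2 = Suc (q ^ 2 - 1)" using q_ge_2 by simp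
  then have "(x ^ q) ^ q = x ^ Suc (q ^ 2 - 1)" by (metis power2_eq_square power_mult)
  then show ?thesis using power_card_minus_1[OF False] by simp
qed (use q_ge_2 in simp)

sublocale conj: semiring_hom "\<lambda>x :: 'a. x ^ q"
  by unfold_locales (use q_ge_2 in \<open>auto simp: conj_add power_mult_distrib\<close>)

lemma star_carrier [simp]: "star q A \<in> carrier_mat n m \<longleftrightarrow> (A :: 'a mat) \<in> carrier_mat m n"
  by (simp add: star_def)

lemma dim_star [simp]: "dim_row (star q A) = dim_col A" "dim_col (star q A) = dim_row (A :: 'a mat)"
  by (simp_all add: star_def)

lemma index_star [simp]:
  "i < dim_col A \<Longrightarrow> j < dim_row A \<Longrightarrow> star q A $$ (i, j) = (A $$ (j, i) :: 'a) ^ q"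
  by (simp add: star_def)

lemma star_star [simp]: "star q (star q A) = (A :: 'a mat)"
  by (intro eq_matI) (auto simp: conj_conj)

lemma star_mult:
  fixes A B :: "'a mat"
  assumes "A \<in> carrier_mat m k" "B \<in> carrier_mat k n"
  shows "star q (A * B) = star q B * star q A"
  using assms unfolding star_def by (simp add: conj.mat_hom_mult transpose_mult[of _ m k _ n])

lemma star_pow:
  fixes A :: "'a mat"
  assumes A: "A \<in> carrier_mat n n"
  shows "star q (A ^\<^sub>m k) = star q A ^\<^sub>m k"
proof (induction k)
  case 0
  show ?case using A q_ge_2 by (intro eq_matI) auto
next
  case (Suc k)
  have "star q (A ^\<^sub>m Suc k) = star q A * star q A ^\<^sub>m k"
    using star_mult[OF pow_carrier_mat[OF A] A] Suc.IH by simp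
  also have "\<dots> = star q A ^\<^sub>m Suc k" using A by (intro pow_mat_Suc_left[symmetric]) simp
  finally show ?case .
qed

text \<open>
  Applying the involution to all entries maps the kernel of \<open>M\<close> injectively into the kernel of the
  conjugate matrix.
\<close>

lemma kernel_dim_conj_le:
  fixes M :: "'a mat"
  shows "kernel_dim M \<le> kernel_dim (map_mat (\<lambda>x. x ^ q) M)"
proof -
  let ?c = "\<lambda>x :: 'a. x ^ q"
  define m n where "m = dim_row M" and "n = dim_col M"
  have M: "M \<in> carrier_mat m n" by (simp add: m_def n_def)
  have cM: "map_mat ?c M \<in> carrier_mat m n" using M by simp
  have "map_vec ?c ` mat_kernel M \<subseteq> mat_kernel (map_mat ?c M)"
  proof
    fix w assume "w \<in> map_vec ?c ` mat_kernel M"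
    then obtain v where v: "v \<in> mat_kernel M" "w = map_vec ?c v" by blast
    note v' = mat_kernelD[OF M v(1)]
    have "map_mat ?c M *\<^sub>v w = map_vec ?c (M *\<^sub>v v)"
      unfolding v(2) using conj.mult_mat_vec_hom[OF M v'(1)] by simp
    also have "\<dots> = 0\<^sub>v m" unfolding v'(2) using q_ge_2 by (intro eq_vecI) auto
    finally show "w \<in> mat_kernel (map_mat ?c M)" using v(2) v'(1) by (intro mat_kernelI[OF cM]) auto
  qed
  moreover have "inj_on (map_vec ?c) (mat_kernel M)"
    by (rule inj_on_inverseI[where g = "map_vec ?c"]) (auto simp: conj_conj)
  moreover have "finite (mat_kernel (map_mat ?c M))"
    using finite_subset[OF mat_kernel_carrier[OF cM]] by simp
  ultimately have "card (mat_kernel M) \<le> card (mat_kernel (map_mat ?c M))"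
    by (metis card_image card_mono)
  then show ?thesis
    using card_field_ge_2[where 'a = 'a] by (simp add: card_mat_kernel[OF M] card_mat_kernel[OF cM])
qed

lemma mat_rank_star: "mat_rank (star q M) = mat_rank (M :: 'a mat)"
proof -
  let ?c = "\<lambda>x :: 'a. x ^ q"
  have "map_mat ?c (map_mat ?c M) = M" by (intro eq_matI) (auto simp: conj_conj)
  then have "kernel_dim (map_mat ?c M) = kernel_dim M"
    using kernel_dim_conj_le[of M] kernel_dim_conj_le[of "map_mat ?c M"] by simp
  then have "mat_rank (map_mat ?c M) = mat_rank M" by (simp add: mat_rank_def)
  moreover have "map_mat ?c M \<in> carrier_mat (dim_row M) (dim_col M)" by simp
  ultimately show ?thesis unfolding star_def using mat_rank_transpose by metis
qed

text \<open>
  \<open>A\<^sup>*A\<close> is self-adjoint, so \<open>A (A\<^sup>*A)\<^sup>j\<close> and \<open>A\<^sup>* (AA\<^sup>*)\<^sup>j\<close> are adjoint to each other and have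
  equal rank.
\<close>

lemma matchable_mu_star:
  fixes A :: "'a mat"
  assumes A: "A \<in> carrier_mat m n" and nil: "nilpotent_mat (A * star q A)"
  shows "matchable (mu (A * star q A)) (mu (star q A * A))"
proof (rule matchable_mu[OF A _ nil])
  show B: "star q A \<in> carrier_mat n m" using A by simp
  fix j
  have BA: "star q A * A \<in> carrier_mat n n" using A B by simp
  have "star q (star q A * A) = star q A * A" using star_mult[OF B A] by simp
  then have "star q (A * (star q A * A) ^\<^sub>m j) = (star q A * A) ^\<^sub>m j * star q A"
    using star_mult[OF A pow_carrier_mat[OF BA]] star_pow[OF BA] by simp
  also have "\<dots> = star q A * (A * star q A) ^\<^sub>m j" by (rule pow_mult_swap[OF B A])
  finally show "mat_rank (star q A * (A * star q A) ^\<^sub>m j) = mat_rank (A * (star q A * A) ^\<^sub>m j)"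
    using mat_rank_star by metis
qed

end

section \<open>Hyperbolic planes in the standard Hermitian form\<close>

lemma card_power_eq_le:
  fixes c :: "'a :: {finite, field}"
  assumes "n > 0"
  shows "card {x. x ^ n = c} \<le> n"
proof -
  let ?p = "Polynomial.monom 1 n + [:- c:]"
  have "degree ?p = n" using assms by (simp add: degree_monom_eq degree_add_eq_left)
  moreover from this have "?p \<noteq> 0" using assms by auto
  moreover have "{x. x ^ n = c} = {x. poly ?p x = 0}" by (auto simp: poly_monom)
  ultimately show ?thesis using poly_roots_degree[of ?p] by simp
qed

context hermitian_field
begin

text \<open>
  The norm \<open>x \<mapsto> x ^ (q + 1)\<close> maps the \<open>(q - 1) * (q + 1)\<close> nonzero elements to the at most \<open>q - 1\<close>
  roots of \<open>y ^ (q - 1) = 1\<close>, with at most \<open>q + 1\<close> elements in each fibre. So the fibre over \<open>-1\<close>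
  has \<open>q + 1\<close> elements; two are enough.
\<close>

lemma two_elements_of_norm_minus_1:
  obtains c d :: 'a where "c \<noteq> d" "c ^ Suc q = - 1" "d ^ Suc q = - 1"
proof -
  let ?U = "UNIV - {0 :: 'a}" and ?Y = "{y :: 'a. y ^ (q - 1) = 1}" and ?f = "\<lambda>x :: 'a. x ^ Suc q"
  let ?S = "{x \<in> ?U. ?f x = - 1}"
  \<comment> \<open>This holds for odd and for even \<open>q\<close>: \<open>-1\<close> is fixed by the involution.\<close>
  have m1: "(- 1 :: 'a) \<in> ?Y"
  proof -
    have "0 = (1 + - 1 :: 'a) ^ q" using q_ge_2 by simp
    also have "\<dots> = 1 + (- 1) ^ q" unfolding conj_add by simp
    finally have "(- 1 :: 'a) ^ q = - 1" by (simp add: eq_neg_iff_add_eq_0 add.commute)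
    moreover have "(- 1 :: 'a) ^ q = - 1 * (- 1) ^ (q - 1)"
      using q_ge_2 by (metis power_eq_if not_numeral_le_zero)
    ultimately show ?thesis by simp
  qed
  have img: "?f ` ?U \<subseteq> ?Y"
  proof
    fix y assume "y \<in> ?f ` ?U"
    then obtain x where x: "x \<noteq> 0" "y = x ^ Suc q" by blast
    have "Suc q * (q - 1) = q ^ 2 - 1" using q_ge_2 by (simp add: power2_eq_square algebra_simps)
    then have "y ^ (q - 1) = x ^ (q ^ 2 - 1)" unfolding x(2) by (metis power_mult)
    then show "y \<in> ?Y" using power_card_minus_1[OF x(1)] by simp
  qed
  have "card ?U = (\<Sum>y\<in>?Y. card {x \<in> ?U. ?f x = y})"
    using sum.group[of ?U ?Y ?f "\<lambda>_. 1 :: nat"] img by simp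
  also have "\<dots> = card ?S + (\<Sum>y\<in>?Y - {- 1}. card {x \<in> ?U. ?f x = y})"
    using m1 by (simp add: sum.remove)
  also have "(\<Sum>y\<in>?Y - {- 1}. card {x \<in> ?U. ?f x = y}) \<le> (\<Sum>y\<in>?Y - {- 1}. Suc q)"
  proof (rule sum_mono)
    fix y
    have "card {x \<in> ?U. ?f x = y} \<le> card {x. ?f x = y}" by (intro card_mono) auto
    also have "\<dots> \<le> Suc q" by (rule card_power_eq_le) simp
    finally show "card {x \<in> ?U. ?f x = y} \<le> Suc q" .
  qed
  also have "\<dots> = (card ?Y - 1) * Suc q" using m1 by (simp add: card_Diff_subset)
  also have "\<dots> \<le> (q - 2) * Suc q"
    using card_power_eq_le[of "q - 1" "1 :: 'a"] q_ge_2 by (intro mult_le_mono1) simp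
  finally have "q ^ 2 - 1 \<le> card ?S + (q - 2) * Suc q" by (simp add: card_Diff_subset card_field)
  moreover obtain t where t: "q = t + 2" using q_ge_2 le_Suc_ex by (metis add.commute)
  ultimately have "card ?S \<ge> 2" unfolding t by (simp add: power2_eq_square algebra_simps)
  then obtain c d where "c \<in> ?S" "d \<in> ?S" "c \<noteq> d"
    by (metis (no_types, lifting) One_nat_def Suc_1 card_le_Suc0_iff_eq finite not_less_eq_eq)
  then show ?thesis using that by auto
qed

text \<open>
  The vectors \<open>(1, c)\<close> and \<open>(1, d)\<close> with \<open>c\<close>, \<open>d\<close> of norm \<open>-1\<close> are isotropic, and they are not
  orthogonal if \<open>c \<noteq> d\<close>; scaling the second one makes their product \<open>1\<close>.
\<close>

lemma hyperbolic_pair: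
  obtains x1 x2 y1 y2 :: 'a where
    "x1 * x1 ^ q + x2 * x2 ^ q = 0" "y1 * y1 ^ q + y2 * y2 ^ q = 0"
    "x1 * y1 ^ q + x2 * y2 ^ q = 1" "y1 * x1 ^ q + y2 * x2 ^ q = 1"
proof -
  obtain c d :: 'a where cd: "c \<noteq> d" "c ^ Suc q = - 1" "d ^ Suc q = - 1"
    by (rule two_elements_of_norm_minus_1)
  have "1 + d * c ^ q \<noteq> 0"
  proof
    assume "1 + d * c ^ q = 0"
    then have "c * (1 + d * c ^ q) = 0" by simp
    then have "c + d * c ^ Suc q = 0" by (simp add: algebra_simps)
    then show False using cd by simp
  qed
  define z where "z = 1 / (1 + d * c ^ q)"
  have z: "z * (1 + d * c ^ q) = 1" using \<open>1 + d * c ^ q \<noteq> 0\<close> by (simp add: z_def)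
  then have "(z * (1 + d * c ^ q)) ^ q = 1" by simp
  then have z': "z ^ q * (1 + d ^ q * c) = 1"
    by (simp add: power_mult_distrib conj_add conj_conj)
  show ?thesis
  proof (rule that[of 1 c z "z * d"])
    show "1 * 1 ^ q + c * c ^ q = 0" using cd(2) by simp
    have "z * z ^ q + z * d * (z * d) ^ q = z * z ^ q * (1 + d ^ Suc q)"
      by (simp add: power_mult_distrib algebra_simps)
    then show "z * z ^ q + z * d * (z * d) ^ q = 0" using cd(3) by simp
    show "1 * z ^ q + c * (z * d) ^ q = 1" using z' by (simp add: power_mult_distrib algebra_simps)
    show "z * 1 ^ q + z * d * c ^ q = 1" using z by (simp add: algebra_simps)
  qed
qed

end

definition exchange_mat :: "nat \<Rightarrow> 'a :: {zero, one} mat" where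
  "exchange_mat k = mat k k (\<lambda>(i, j). if j = k - 1 - i then 1 else 0)"

text \<open>
  The rows of \<open>P\<close> with numbers \<open>i\<close> and \<open>k - 1 - i\<close> are a hyperbolic pair in the plane of the
  coordinates \<open>i\<close> and \<open>k - 1 - i\<close>. For odd \<open>k\<close> the middle row is a unit vector.
\<close>

lemma (in hermitian_field) exchange_mat_is_gram_matrix:
  obtains P :: "'a mat" where "P \<in> carrier_mat k k" "P * star q P = exchange_mat k"
proof -
  obtain x1 x2 y1 y2 :: 'a where h: "x1 * x1 ^ q + x2 * x2 ^ q = 0" "y1 * y1 ^ q + y2 * y2 ^ q = 0"
    "x1 * y1 ^ q + x2 * y2 ^ q = 1" "y1 * x1 ^ q + y2 * x2 ^ q = 1"
    by (rule hyperbolic_pair)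
  define f where "f i j = (let i' = k - 1 - i in
     if j = i then if i = i' then 1 else if i < i' then x1 else y2
     else if j = i' then if i < i' then x2 else y1
     else 0)" for i j
  define P where "P = mat k k (\<lambda>(i, j). f i j)"
  have P: "P \<in> carrier_mat k k" by (simp add: P_def)
  have "P * star q P = exchange_mat k"
  proof (rule eq_matI)
    fix i l assume "i < dim_row (exchange_mat k :: 'a mat)" "l < dim_col (exchange_mat k :: 'a mat)"
    then have il: "i < k" "l < k" by (simp_all add: exchange_mat_def)
    define i' where "i' = k - 1 - i"
    have i': "i' < k" "k - 1 - i' = i" using il by (auto simp: i'_def)
    have fi: "f i j = (if j = i then if i = i' then 1 else if i < i' then x1 else y2
        else if j = i' then if i < i' then x2 else y1 else 0)" for j
      unfolding f_def Let_def i'_def ..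
    have fi': "f i' j = (if j = i' then if i' = i then 1 else if i' < i then x1 else y2
        else if j = i then if i' < i then x2 else y1 else 0)" for j
      unfolding f_def Let_def i'(2) ..
    have "(P * star q P) $$ (i, l) = (\<Sum>j = 0..<k. f i j * f l j ^ q)"
      using il by (simp add: P_def scalar_prod_def)
    also have "\<dots> = (\<Sum>j\<in>{i, i'}. f i j * f l j ^ q)"
    proof (rule sum.mono_neutral_right)
      show "\<forall>j\<in>{0..<k} - {i, i'}. f i j * f l j ^ q = 0" by (simp add: fi)
    qed (use il i' in auto)
    also have "\<dots> = (if l = i' then 1 else 0)"
    proof (cases "l = i \<or> l = i'")
      case False
      then have "k - 1 - l \<noteq> i" "k - 1 - l \<noteq> i'" using il by (auto simp: i'_def)
      then have "f l i = 0" "f l i' = 0" using False by (auto simp: f_def Let_def)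
      then show ?thesis using False q_ge_2 by (simp add: sum.insert_if)
    next
      case True
      consider "i = i'" | "i < i'" | "i' < i" by linarith
      then show ?thesis
      proof cases
        case 1
        have "f i i = 1" unfolding fi using 1 by simp
        moreover have "l = i" using 1 True by simp
        ultimately show ?thesis using 1 by simp
      next
        case 2
        then have "f i i = x1" "f i i' = x2" "f i' i = y1" "f i' i' = y2"
          unfolding fi fi' by simp_all
        then show ?thesis using 2 True h by auto
      next
        case 3
        then have "f i i = y2" "f i i' = y1" "f i' i = x2" "f i' i' = x1"
          unfolding fi fi' by simp_all
        then show ?thesis using 3 True h by (auto simp: add.commute)
      qed
    qed
    finally show "(P * star q P) $$ (i, l) = exchange_mat k $$ (i, l)"
      using il by (simp add: exchange_mat_def i'_def)
  qed (simp_all add: P_def exchange_mat_def)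
  with P show ?thesis using that by blast
qed

text \<open>
  Row \<open>i\<close> is the unit vector number \<open>f i\<close>, and it is zero if \<open>f i \<ge> n\<close>. Partial maps are thus
  encoded by values that are out of range, and products become compositions.
\<close>

definition row_select_mat :: "nat \<Rightarrow> nat \<Rightarrow> (nat \<Rightarrow> nat) \<Rightarrow> 'a :: {zero, one} mat" where
  "row_select_mat m n f = mat m n (\<lambda>(i, j). if j = f i then 1 else 0)"

lemma row_select_mat_carrier [simp]: "row_select_mat m n f \<in> carrier_mat m n"
  by (simp add: row_select_mat_def)

lemma row_select_mat_cong:
  assumes "\<And>i. i < m \<Longrightarrow> f i = g i \<or> n \<le> f i \<and> n \<le> g i"
  shows "row_select_mat m n f = row_select_mat m n g"
  unfolding row_select_mat_def by (intro cong_mat) (use assms in \<open>force+\<close>)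

lemma row_select_mat_mult:
  "row_select_mat m n f * row_select_mat n k g =
    (row_select_mat m k (\<lambda>i. if f i < n then g (f i) else k) :: 'a :: comm_semiring_1 mat)"
proof (rule eq_matI)
  fix i j
  assume "i < dim_row (row_select_mat m k (\<lambda>i. if f i < n then g (f i) else k) :: 'a mat)"
    and "j < dim_col (row_select_mat m k (\<lambda>i. if f i < n then g (f i) else k) :: 'a mat)"
  then have ij: "i < m" "j < k" by (simp_all add: row_select_mat_def)
  have "(row_select_mat m n f * row_select_mat n k g :: 'a mat) $$ (i, j) =
      (\<Sum>l = 0..<n. (if l = f i then 1 else 0) * (if j = g l then 1 else 0))"
    using ij by (simp add: row_select_mat_def scalar_prod_def)
  also have "\<dots> = (\<Sum>l = 0..<n. if l = f i then (if j = g (f i) then 1 else 0) else 0)"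
    by (intro sum.cong) auto
  also have "\<dots> = (if f i < n \<and> j = g (f i) then 1 else 0)" by (simp add: sum.delta)
  finally show "(row_select_mat m n f * row_select_mat n k g :: 'a mat) $$ (i, j) =
      row_select_mat m k (\<lambda>i. if f i < n then g (f i) else k) $$ (i, j)"
    using ij by (auto simp: row_select_mat_def)
qed (simp_all add: row_select_mat_def)

lemma exchange_mat_eq: "exchange_mat k = row_select_mat k k (\<lambda>i. k - 1 - i)"
  by (simp add: exchange_mat_def row_select_mat_def)

lemma one_mat_eq: "1\<^sub>m k = row_select_mat k k (\<lambda>i. i)"
  by (intro eq_matI) (auto simp: row_select_mat_def)

lemma exchange_mat_involution: "exchange_mat k * exchange_mat k = (1\<^sub>m k :: 'a :: comm_semiring_1 mat)"
  unfolding exchange_mat_eq one_mat_eq row_select_mat_mult by (rule row_select_mat_cong) auto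

lemma exchange_conjugate_row_select:
  "exchange_mat m * row_select_mat m n f * exchange_mat n =
    (row_select_mat m n (\<lambda>i. if f (m - 1 - i) < n then n - 1 - f (m - 1 - i) else n) :: 'a :: comm_semiring_1 mat)"
  unfolding exchange_mat_eq row_select_mat_mult by (rule row_select_mat_cong) auto

lemma jordan_block_0_eq: "jordan_block n (0 :: 'a :: comm_semiring_1) = row_select_mat n n Suc"
  by (intro eq_matI) (auto simp: row_select_mat_def)


section \<open>Realizing pairs of Jordan types\<close>

context hermitian_field
begin

text \<open>
  Multisets make this predicate additive; the order of the blocks of a Jordan normal form is
  arbitrary.
\<close>

definition realizable :: "nat multiset \<Rightarrow> nat multiset \<Rightarrow> bool" where
  "realizable a b \<longleftrightarrow> (\<exists>(A :: 'a mat) as bs. mset as = a \<and> mset bs = b \<and>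
     jordan_nf (A * star q A) (map (\<lambda>l. (l, 0)) as) \<and>
     jordan_nf (star q A * A) (map (\<lambda>l. (l, 0)) bs))"

lemma realizable_swap:
  assumes "realizable a b"
  shows "realizable b a"
proof -
  obtain A :: "'a mat" and as bs where "mset as = a" "mset bs = b"
    "jordan_nf (A * star q A) (map (\<lambda>l. (l, 0)) as)"
    "jordan_nf (star q A * A) (map (\<lambda>l. (l, 0)) bs)"
    using assms unfolding realizable_def by blast
  then show ?thesis unfolding realizable_def
    by (intro exI[of _ "star q A"] exI[of _ bs] exI[of _ as]) simp
qed

lemma jordan_nf_block_sum:
  fixes A B :: "'b :: field mat"
  assumes A: "A \<in> carrier_mat m m" and B: "B \<in> carrier_mat n n"
    and "jordan_nf A xs" "jordan_nf B ys"
  shows "jordan_nf (four_block_mat A (0\<^sub>m m n) (0\<^sub>m n m) B) (xs @ ys)"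
proof -
  have 0: "0 \<notin> fst ` set (xs @ ys)" and sim: "similar_mat A (jordan_matrix xs)" "similar_mat B (jordan_matrix ys)"
    using assms(3,4) unfolding jordan_nf_def by auto
  have dims: "dim_row (jordan_matrix xs) = m" "dim_col (jordan_matrix xs) = m"
    "dim_row (jordan_matrix ys) = n" "dim_col (jordan_matrix ys) = n"
    using similar_matD[OF sim(1)] similar_matD[OF sim(2)] A B by (metis carrier_matD insert_subset)+
  have "jordan_matrix (xs @ ys) = four_block_mat (jordan_matrix xs) (0\<^sub>m m n) (0\<^sub>m n m) (jordan_matrix ys)"
    unfolding jordan_matrix_def map_append diag_block_mat_append
    using dims unfolding jordan_matrix_def by (simp add: Let_def)
  then show ?thesis
    using 0 similar_mat_four_block_0_0[OF sim A B] unfolding jordan_nf_def by simp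
qed

lemma realizable_add:
  assumes "realizable a b" "realizable a' b'"
  shows "realizable (a + a') (b + b')"
proof -
  obtain A :: "'a mat" and as bs where A: "mset as = a" "mset bs = b"
    "jordan_nf (A * star q A) (map (\<lambda>l. (l, 0)) as)"
    "jordan_nf (star q A * A) (map (\<lambda>l. (l, 0)) bs)"
    using assms(1) unfolding realizable_def by blast
  obtain B :: "'a mat" and as' bs' where B: "mset as' = a'" "mset bs' = b'"
    "jordan_nf (B * star q B) (map (\<lambda>l. (l, 0)) as')"
    "jordan_nf (star q B * B) (map (\<lambda>l. (l, 0)) bs')"
    using assms(2) unfolding realizable_def by blast
  define m n m' n' where "m = dim_row A" and "n = dim_col A" and "m' = dim_row B" and "n' = dim_col B"
  have cA: "A \<in> carrier_mat m n" and cB: "B \<in> carrier_mat m' n'"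
    by (simp_all add: m_def n_def m'_def n'_def)
  have sA: "star q A \<in> carrier_mat n m" and sB: "star q B \<in> carrier_mat n' m'" using cA cB by auto
  let ?C = "four_block_mat A (0\<^sub>m m n') (0\<^sub>m m' n) B"
  have star: "star q ?C = four_block_mat (star q A) (0\<^sub>m n m') (0\<^sub>m n' m) (star q B)"
    using cA cB q_ge_2 by (intro eq_matI) auto
  have 1: "?C * star q ?C = four_block_mat (A * star q A) (0\<^sub>m m m') (0\<^sub>m m' m) (B * star q B)"
    unfolding star using cA cB sA sB
    by (simp add: mult_four_block_mat[OF cA zero_carrier_mat zero_carrier_mat cB sA zero_carrier_mat zero_carrier_mat sB])
  have 2: "star q ?C * ?C = four_block_mat (star q A * A) (0\<^sub>m n n') (0\<^sub>m n' n) (star q B * B)"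
    unfolding star using cA cB sA sB
    by (simp add: mult_four_block_mat[OF sA zero_carrier_mat zero_carrier_mat sB cA zero_carrier_mat zero_carrier_mat cB])
  show ?thesis unfolding realizable_def
  proof (intro exI conjI)
    show "mset (as @ as') = a + a'" "mset (bs @ bs') = b + b'" using A B by auto
    show "jordan_nf (?C * star q ?C) (map (\<lambda>l. (l, 0)) (as @ as'))"
      unfolding 1 map_append by (rule jordan_nf_block_sum[OF _ _ A(3) B(3)]) (use cA sA cB sB in auto)
    show "jordan_nf (star q ?C * ?C) (map (\<lambda>l. (l, 0)) (bs @ bs'))"
      unfolding 2 map_append by (rule jordan_nf_block_sum[OF _ _ A(4) B(4)]) (use cA sA cB sB in auto)
  qed
qed

lemma jordan_nf_jordan_matrix:
  "0 \<notin> set ls \<Longrightarrow> jordan_nf (jordan_matrix (map (\<lambda>l. (l, 0 :: 'b :: field)) ls)) (map (\<lambda>l. (l, 0)) ls)"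
  unfolding jordan_nf_def using similar_mat_refl[OF jordan_matrix_carrier] by force

lemma realizable_empty: "realizable {#} {#}"
proof -
  have eq: "(0\<^sub>m 0 0 * star q (0\<^sub>m 0 0) :: 'a mat) = jordan_matrix (map (\<lambda>l. (l, 0)) [])"
    "(star q (0\<^sub>m 0 0) * 0\<^sub>m 0 0 :: 'a mat) = jordan_matrix (map (\<lambda>l. (l, 0)) [])"
    by (intro eq_matI; simp)+
  have "jordan_nf (jordan_matrix (map (\<lambda>l. (l, 0 :: 'a)) [])) (map (\<lambda>l. (l, 0)) [])"
    by (rule jordan_nf_jordan_matrix) simp
  then show ?thesis unfolding realizable_def
    by (intro exI[of _ "0\<^sub>m 0 0"] exI[of _ "[]"] conjI; (simp only: eq mset.simps)?)
qed

lemma realizable_repeat: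
  assumes "realizable a b"
  shows "realizable (repeat_mset k a) (repeat_mset k b)"
  by (induction k) (use realizable_empty realizable_add[OF assms] in auto)

lemma realizable_sum:
  assumes "\<And>r. r < (N :: nat) \<Longrightarrow> realizable (f r) (g r)"
  shows "realizable (\<Sum>r<N. f r) (\<Sum>r<N. g r)"
  using assms by (induction N) (auto intro: realizable_empty realizable_add)

text \<open>
  \<open>X\<close> has entries \<open>0\<close> and \<open>1\<close>, so its transpose is the adjoint of \<open>Y\<close> with respect to the Hermitian
  forms whose Gram matrices are the exchange matrices. Passing to orthonormal bases turns \<open>Y\<close> into
  a matrix \<open>A\<close> and its adjoint into \<open>star q A\<close>.
\<close>

lemma realizable_from_selection:
  fixes m n :: nat and f :: "nat \<Rightarrow> nat"
  defines "X \<equiv> (row_select_mat m n f :: 'a mat)"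
  defines "Y \<equiv> exchange_mat m * X * exchange_mat n"
  assumes pos: "0 \<notin> set as" "0 \<notin> set bs"
    and YX: "Y * transpose_mat X = jordan_matrix (map (\<lambda>l. (l, 0)) as)"
    and XY: "transpose_mat X * Y = jordan_matrix (map (\<lambda>l. (l, 0)) bs)"
  shows "realizable (mset as) (mset bs)"
proof -
  obtain P :: "'a mat" where P: "P \<in> carrier_mat m m" and PP: "P * star q P = exchange_mat m"
    by (rule exchange_mat_is_gram_matrix)
  obtain Q :: "'a mat" where Q: "Q \<in> carrier_mat n n" and QQ: "Q * star q Q = exchange_mat n"
    by (rule exchange_mat_is_gram_matrix)
  let ?J = "exchange_mat m :: 'a mat" and ?K = "exchange_mat n :: 'a mat"
  let ?P = "star q P" and ?Q = "star q Q" and ?X = "transpose_mat X"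
  have J: "?J \<in> carrier_mat m m" and K: "?K \<in> carrier_mat n n" by (simp_all add: exchange_mat_eq)
  have sP: "?P \<in> carrier_mat m m" and sQ: "?Q \<in> carrier_mat n n" using P Q by auto
  have X: "X \<in> carrier_mat m n" and Xt: "?X \<in> carrier_mat n m" by (simp_all add: X_def)
  have sX: "star q X = ?X" using q_ge_2 by (intro eq_matI) (auto simp: X_def row_select_mat_def)
  note assoc = assoc_mult_mat[of _ m m _ m _ m] assoc_mult_mat[of _ m m _ m _ n] assoc_mult_mat[of _ m m _ n _ n]
    assoc_mult_mat[of _ m m _ n _ m] assoc_mult_mat[of _ m n _ n _ n] assoc_mult_mat[of _ m n _ n _ m]
    assoc_mult_mat[of _ m n _ m _ n] assoc_mult_mat[of _ m n _ m _ m]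
    assoc_mult_mat[of _ n n _ n _ n] assoc_mult_mat[of _ n n _ n _ m] assoc_mult_mat[of _ n n _ m _ m]
    assoc_mult_mat[of _ n n _ m _ n] assoc_mult_mat[of _ n m _ m _ m] assoc_mult_mat[of _ n m _ m _ n]
    assoc_mult_mat[of _ n m _ n _ m] assoc_mult_mat[of _ n m _ n _ n]
  note c = P Q sP sQ J K X Xt
  have JJ: "?J * ?J = 1\<^sub>m m" and KK: "?K * ?K = 1\<^sub>m n" by (rule exchange_mat_involution)+
  have P1: "P * (?P * ?J) = 1\<^sub>m m" using c by (simp add: JJ PP flip: assoc_mult_mat[of _ m m _ m _ m])
  then have P2: "?P * ?J * P = 1\<^sub>m m" using mat_mult_left_right_inverse[of P m "?P * ?J"] c by simp
  have Q1: "Q * (?Q * ?K) = 1\<^sub>m n" using c by (simp add: KK QQ flip: assoc_mult_mat[of _ n n _ n _ n])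
  then have Q2: "?Q * ?K * Q = 1\<^sub>m n" using mat_mult_left_right_inverse[of Q n "?Q * ?K"] c by simp
  \<comment> \<open>\<open>P\<close> and \<open>Q\<close> satisfy \<open>P\<^sup>-\<^sup>1 = P\<^sup>* J\<close> and \<open>Q\<^sup>-\<^sup>1 = Q\<^sup>* K\<close> for the exchange matrices \<open>J\<close>, \<open>K\<close>,
    so both products below are conjugates of products of \<open>Y\<close> and the transpose of \<open>X\<close>.\<close>
  define A where "A = ?P * X * Q"
  have A: "A \<in> carrier_mat m n" using c by (simp add: A_def)
  have sA: "star q A = ?Q * ?X * P"
  proof -
    have "star q A = ?Q * star q (?P * X)" unfolding A_def by (rule star_mult) (use c in auto)
    also have "star q (?P * X) = ?X * P" using star_mult[OF sP X] sX by simp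
    finally show ?thesis using c by (simp add: assoc)
  qed
  have Y: "Y \<in> carrier_mat m n" using c by (simp add: Y_def)
  have 1: "A * star q A = (?P * ?J) * (Y * ?X) * P"
  proof -
    have "A * star q A = ?P * X * (Q * ?Q) * ?X * P" unfolding sA unfolding A_def using c by (simp add: assoc)
    also have "\<dots> = ?P * (?J * ?J) * X * ?K * ?X * P" unfolding QQ JJ using c by simp
    also have "\<dots> = (?P * ?J) * (Y * ?X) * P" unfolding Y_def using c by (simp add: assoc)
    finally show ?thesis .
  qed
  have 2: "star q A * A = ?Q * (?X * Y) * (?K * Q)"
  proof -
    have "star q A * A = ?Q * ?X * (P * ?P) * X * Q" unfolding sA unfolding A_def using c by (simp add: assoc)
    also have "\<dots> = ?Q * ?X * ?J * X * (?K * ?K) * Q" unfolding PP KK using c by simp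
    also have "\<dots> = ?Q * (?X * Y) * (?K * Q)" unfolding Y_def using c by (simp add: assoc)
    finally show ?thesis .
  qed
  have "similar_mat (A * star q A) (Y * ?X)"
    by (rule similar_matI[OF _ P2 P1 1]) (use c Y A in auto)
  moreover have "similar_mat (star q A * A) (?X * Y)"
  proof (rule similar_matI[OF _ _ _ 2])
    show "?Q * (?K * Q) = 1\<^sub>m n" using Q2 c by (simp add: assoc)
    show "?K * Q * ?Q = 1\<^sub>m n" using QQ KK c by (simp add: assoc)
  qed (use c Y A in auto)
  ultimately have "jordan_nf (A * star q A) (map (\<lambda>l. (l, 0)) as)" "jordan_nf (star q A * A) (map (\<lambda>l. (l, 0)) bs)"
    using pos unfolding jordan_nf_def YX XY by auto
  then show ?thesis unfolding realizable_def by blast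
qed

lemma jordan_matrix_single: "jordan_matrix [(k, a)] = jordan_block k a"
  unfolding jordan_matrix_def by (simp only: list.map split diag_block_mat_singleton)

text \<open>
  The string alternates between \<open>r + 1\<close> vectors on one side and \<open>r\<close> on the other: \<open>X\<close> places a
  vector of length \<open>r\<close> in the last \<open>r\<close> of \<open>r + 1\<close> coordinates and \<open>Y\<close> in the first \<open>r\<close>, so the
  products of one with the transpose of the other are shifts.
\<close>

lemma realizable_odd_string: "realizable {#Suc r#} (if r = 0 then {#} else {#r#})"
proof -
  define bs where "bs = (if r = 0 then [] else [r])"
  let ?f = "\<lambda>i. if i = 0 then r else i - 1"
  let ?X = "row_select_mat (Suc r) r ?f :: 'a mat"
  have Xt: "transpose_mat ?X = row_select_mat r (Suc r) Suc"
    by (intro eq_matI) (auto simp: row_select_mat_def)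
  have Y: "exchange_mat (Suc r) * ?X * exchange_mat r = row_select_mat (Suc r) r (\<lambda>i. i)"
    unfolding exchange_conjugate_row_select by (rule row_select_mat_cong) auto
  have "realizable (mset [Suc r]) (mset bs)"
  proof (rule realizable_from_selection[of _ _ "Suc r" r ?f])
    show "exchange_mat (Suc r) * ?X * exchange_mat r * transpose_mat ?X =
        jordan_matrix (map (\<lambda>l. (l, 0)) [Suc r])"
      unfolding Y Xt row_select_mat_mult
      unfolding list.map jordan_matrix_single jordan_block_0_eq by (rule row_select_mat_cong) auto
    have "transpose_mat ?X * (exchange_mat (Suc r) * ?X * exchange_mat r) = row_select_mat r r Suc"
      unfolding Y Xt row_select_mat_mult by (rule row_select_mat_cong) auto
    also have "\<dots> = jordan_matrix (map (\<lambda>l. (l, 0)) bs)"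
      by (cases "r = 0") (auto simp: bs_def jordan_matrix_single jordan_block_0_eq row_select_mat_def intro!: eq_matI)
    finally show "transpose_mat ?X * (exchange_mat (Suc r) * ?X * exchange_mat r) =
      jordan_matrix (map (\<lambda>l. (l, 0)) bs)" .
  qed (auto simp: bs_def)
  then show ?thesis by (simp add: bs_def split: if_splits)
qed

text \<open>
  Two strings starting on different sides are dual to each other. On the first \<open>r\<close> coordinates
  \<open>X\<close> is a shift and \<open>Y\<close> the identity, on the last \<open>r\<close> coordinates the roles are exchanged; so
  both products are the sum of two shifts of size \<open>r\<close>.
\<close>

lemma realizable_even_strings:
  assumes "r > 0"
  shows "realizable {#r, r#} {#r, r#}"
proof -
  let ?f = "\<lambda>i. if i = 0 then 2 * r else if i < r then i - 1 else i"
  let ?X = "row_select_mat (2 * r) (2 * r) ?f :: 'a mat"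
  let ?J = "exchange_mat (2 * r) :: 'a mat"
  have Xt: "transpose_mat ?X = row_select_mat (2 * r) (2 * r) (\<lambda>i. if r \<le> i then i else if Suc i < r then Suc i else 2 * r)"
    using assms by (intro eq_matI) (auto simp: row_select_mat_def)
  have Y: "?J * ?X * ?J = row_select_mat (2 * r) (2 * r) (\<lambda>i. if i < r then i else Suc i)"
    unfolding exchange_conjugate_row_select by (rule row_select_mat_cong) (use assms in auto)
  have target: "jordan_matrix (map (\<lambda>l. (l, 0)) [r, r]) =
      (row_select_mat (2 * r) (2 * r) (\<lambda>i. if Suc i = r then 2 * r else Suc i) :: 'a mat)"
    by (intro eq_matI) (auto simp: jordan_matrix_def jordan_block_0_eq row_select_mat_def Let_def)
  have "realizable (mset [r, r]) (mset [r, r])"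
  proof (rule realizable_from_selection[of _ _ "2 * r" "2 * r" ?f])
    show "?J * ?X * ?J * transpose_mat ?X = jordan_matrix (map (\<lambda>l. (l, 0)) [r, r])"
      unfolding target Y Xt row_select_mat_mult by (rule row_select_mat_cong) (use assms in auto)
    show "transpose_mat ?X * (?J * ?X * ?J) = jordan_matrix (map (\<lambda>l. (l, 0)) [r, r])"
      unfolding target Y Xt row_select_mat_mult by (rule row_select_mat_cong) (use assms in auto)
  qed (use assms in auto)
  then show ?thesis by simp
qed

lemma matchable_imp_realizable:
  assumes pos: "0 \<notin> set \<alpha>" "0 \<notin> set \<beta>" and m: "matchable \<alpha> \<beta>"
  shows "realizable (mset \<alpha>) (mset \<beta>)"
proof -
  obtain u d e where even: "\<And>r. even (e r)"
    and ca: "\<And>r. count (mset \<alpha>) (Suc r) = u r + d (Suc r) + e r"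
    and cb: "\<And>r. count (mset \<beta>) (Suc r) = d r + u (Suc r) + e r"
    using m unfolding matchable_def by metis
  define N where "N = sum_list \<alpha> + sum_list \<beta>"
  \<comment> \<open>A part \<open>0\<close> is only padding and contributes nothing.\<close>
  define z where "z r = (if r = 0 then {#} else {#r#})" for r :: nat
  define f where "f u d r = repeat_mset (u r) {#Suc r#} + repeat_mset (d r) (z r) +
    repeat_mset (e r div 2) {#Suc r, Suc r#}" for u d r
  have "realizable (f u d r) (f d u r)" for r
  proof -
    have 1: "realizable {#Suc r#} (z r)" unfolding z_def by (rule realizable_odd_string)
    have "realizable (repeat_mset (u r) {#Suc r#} + repeat_mset (d r) (z r))
        (repeat_mset (u r) (z r) + repeat_mset (d r) {#Suc r#})"
      by (intro realizable_add realizable_repeat 1 realizable_swap[OF 1])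
    from realizable_add[OF this realizable_repeat[OF realizable_even_strings, of "Suc r" "e r div 2"]]
    show ?thesis by (simp add: f_def add_ac)
  qed
  then have real: "realizable (\<Sum>r<N. f u d r) (\<Sum>r<N. f d u r)" by (rule realizable_sum)
  have zero: "u r = 0" "d r = 0" "e r = 0" if "r \<ge> N" for r
    using that ca[of r] cb[of r] count_eq_0_of_sum_less[of \<alpha> "Suc r"] count_eq_0_of_sum_less[of \<beta> "Suc r"]
    by (auto simp: N_def)
  have sum: "(\<Sum>r<N. f u d r) = mset \<gamma>"
    if "0 \<notin> set \<gamma>" "\<And>r. count (mset \<gamma>) (Suc r) = u r + d (Suc r) + e r"
      "\<And>r. r \<ge> N \<Longrightarrow> u r = 0" "\<And>r. r \<ge> N \<Longrightarrow> d r = 0" for u d \<gamma>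
  proof (rule multiset_eqI)
    fix x
    show "count (\<Sum>r<N. f u d r) x = count (mset \<gamma>) x"
    proof (cases x)
      case 0
      have "count (f u d r) 0 = 0" for r by (simp add: f_def z_def)
      then show ?thesis using that(1) 0 by (simp add: count_sum count_eq_zero_iff)
    next
      case (Suc s)
      have "count (f u d r) (Suc s) = (if r = s then u s + e s else 0) + (if r = Suc s then d (Suc s) else 0)" for r
        using even[of r] by (auto simp: f_def z_def)
      then have "count (\<Sum>r<N. f u d r) (Suc s) =
          (\<Sum>r<N. if r = s then u s + e s else 0) + (\<Sum>r<N. if r = Suc s then d (Suc s) else 0)"
        by (simp add: count_sum sum.distrib)
      also have "\<dots> = u s + e s + d (Suc s)"
        using that(3)[of s] that(4)[of "Suc s"] zero(3)[of s] by (auto simp: sum.delta not_less)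
      finally show ?thesis using Suc that(2) by simp
    qed
  qed
  show ?thesis using real sum[of \<alpha> u d] sum[of \<beta> d u] pos ca cb zero by simp
qed

end

section \<open>Jordan types of \<open>AA\<^sup>*\<close> and \<open>A\<^sup>*A\<close>\<close>

theorem theorem1p6:
  fixes q m n :: nat and \<alpha> \<beta> :: "nat list"
  assumes "primepow q"
    and "CARD('a :: {finite, field}) = q ^ 2"
    and "m > 0" and "n > 0"
    and "partition_of \<alpha> m" and "partition_of \<beta> n"
  shows "(\<exists>A :: 'a mat. A \<in> carrier_mat m n \<and> nilpotent_mat (A * star q A) \<and>
             mu (star q A * A) = \<beta> \<and> mu (A * star q A) = \<alpha>) \<longleftrightarrow>
         (\<forall>i. \<bar>int (part \<alpha> i) - int (part \<beta> i)\<bar> \<le> 1) \<and>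
         (\<forall>i j. is_component (gamma \<alpha> \<beta>) i j \<and> 1 \<notin> (!) (gamma \<alpha> \<beta>) ` {i..<j} \<longrightarrow>
                even (j - i))"
proof -
  interpret hermitian_field q "TYPE('a)" by unfold_locales (fact assms(1,2))+
  have sorted: "sorted_wrt (\<ge>) \<alpha>" "sorted_wrt (\<ge>) \<beta>" and pos: "0 \<notin> set \<alpha>" "0 \<notin> set \<beta>"
    and sum: "sum_list \<alpha> = m" "sum_list \<beta> = n"
    using assms(5,6) by (auto simp: partition_of_def)
  have rev_sort: "rev (sort xs) = ys" if "mset xs = mset ys" "sorted_wrt (\<ge>) ys" for xs ys :: "nat list"
  proof -
    have "sort xs = rev ys" using that by (intro properties_for_sort) (simp_all add: sorted_wrt_rev)
    then show ?thesis by simp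
  qed
  have "(\<exists>A :: 'a mat. A \<in> carrier_mat m n \<and> nilpotent_mat (A * star q A) \<and>
      mu (star q A * A) = \<beta> \<and> mu (A * star q A) = \<alpha>) \<longleftrightarrow> matchable \<alpha> \<beta>" (is "?L \<longleftrightarrow> _")
  proof
    assume ?L
    then show "matchable \<alpha> \<beta>" using matchable_mu_star by blast
  next
    assume "matchable \<alpha> \<beta>"
    then have "realizable (mset \<alpha>) (mset \<beta>)" by (rule matchable_imp_realizable[OF pos])
    then obtain A :: "'a mat" and as bs where ms: "mset as = mset \<alpha>" "mset bs = mset \<beta>"
      and nf: "jordan_nf (A * star q A) (map (\<lambda>l. (l, 0)) as)" "jordan_nf (star q A * A) (map (\<lambda>l. (l, 0)) bs)"
      unfolding realizable_def by blast
    have dim: "dim_row N = sum_list ls" if "jordan_nf N (map (\<lambda>l. (l, 0)) ls)" for N :: "'a mat" and ls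
    proof -
      have "similar_mat N (jordan_matrix (map (\<lambda>l. (l, 0)) ls))" using that by (simp add: jordan_nf_def)
      then obtain k where "N \<in> carrier_mat k k" "jordan_matrix (map (\<lambda>l. (l, 0 :: 'a)) ls) \<in> carrier_mat k k"
        using similar_matD by blast
      then show ?thesis using carrier_matD(1) by (auto simp: o_def)
    qed
    have "sum_list as = m" "sum_list bs = n" using ms sum by (metis sum_mset_sum_list)+
    then have "A \<in> carrier_mat m n" using dim[OF nf(1)] dim[OF nf(2)] by (intro carrier_matI) simp_all
    moreover have "mu (A * star q A) = \<alpha>" "mu (star q A * A) = \<beta>"
      using mu_nilpotent[OF nf(1)] mu_nilpotent[OF nf(2)] rev_sort ms sorted by simp_all
    ultimately show ?L using jordan_nf_imp_nilpotent[OF nf(1)] by blast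
  qed
  then show ?thesis unfolding matchable_iff[OF sorted] .
qed

end
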